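(* Let $F$ be a fixed graph with at least one edge, and put \[ p^*=p^*(n)=N^{-1/\rho^{\max}(F)}\sqrt{\ln N}. \] Then $p^*$ is a threshold probability for the property "$G_p$ contains a copy of $F$": if $p=o(p^* )$ then $\Pr(G_p \text{ contains a copy of } F)\to 0$ as $n\to\infty$, and if $p/p^*\to\infty$ then $\Pr(G_p \text{ contains a copy of } F)\to 1$. Moreover, if $p/p^*\to\infty$, then for every $\varepsilon>0$, \[ \Pr\left(\left|\frac{X_F}{\mathbb{E} X_F}-1\right|<\varepsilon\right)\to 1 \quad (n\to\infty), \] where $X_F$ is the number of copies of $F$ in $G_p$.
   Context: Throughout, $n$ ranges over positive integers divisible by $4$ and asymptotics are as $n\to\infty$. The complete distance graph $G=G(n,n/2,n/4)=(V,E)$ has vertex set $V=\{\mathbf{x}=(x_1,\dots,x_n)\in\{0,1\}^n : x_1+\dots+x_n=n/2\}$ and edge set $E=\{\{\mathbf{x},\mathbf{y}\}: \langle \mathbf{x},\mathbf{y}\rangle=n/4\}$, where $\langle\cdot,\cdot\rangle$ is the Euclidean inner product. Let $N=|V|=\binom{n}{n/2}$ and $N_1=\binom{n/2}{n/4}^2$ (the common degree of vertices of $G$). The random distance graph $G_p=G_p(n,n/2,n/4)$, $p=p(n)\in[0,1]$, is the random spanning subgraph of $G$ in which each edge of $G$ is kept independently with probability $p$. For a graph $H$ with $v(H)$ vertices and $e(H)$ edges, $\rho(H)=e(H)/v(H)$, and the maximal density of $F$ is $\rho^{\max}(F)=\max\{e(H)/v(H): H\subseteq F,\ v(H)\neq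 0\}$. *)

theory Defs
  imports "HOL-Probability.Probability" "HOL-Library.Landau_Symbols"
begin

definition inner :: "nat list \<Rightarrow> nat list \<Rightarrow> nat" where
  "inner x y = sum_list (map2 (*) x y)"

definition dg_V :: "nat \<Rightarrow> nat list set" where
  "dg_V n = {x. length x = n \<and> set x \<subseteq> {0,1} \<and> sum_list x = n div 2}"

definition dg_E :: "nat \<Rightarrow> nat list set set" where
  "dg_E n = {{x, y} | x y. x \<in> dg_V n \<and> y \<in> dg_V n \<and> inner x y = n div 4}"

definition dg_N :: "nat \<Rightarrow> real" where
  "dg_N n = real (card (dg_V n))"

text \<open>The random distance graph G_p, represented by its (random) edge set:
  each edge of G is kept independently with probability p.\<close>
definition Gp :: "nat \<Rightarrow> real \<Rightarrow> nat list set set pmf" where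
  "Gp n p = map_pmf (\<lambda>\<omega>. {e \<in> dg_E n. \<omega> e}) (Pi_pmf (dg_E n) False (\<lambda>_. bernoulli_pmf p))"

definition simple_graph :: "'a set \<Rightarrow> 'a set set \<Rightarrow> bool" where
  "simple_graph VF EF \<longleftrightarrow> finite VF \<and> (\<forall>e\<in>EF. e \<subseteq> VF \<and> card e = 2)"

definition rho_max :: "'a set \<Rightarrow> 'a set set \<Rightarrow> real" where
  "rho_max VF EF = Max {real (card D) / real (card W) | W D.
      W \<subseteq> VF \<and> W \<noteq> {} \<and> D \<subseteq> EF \<and> (\<forall>e\<in>D. e \<subseteq> W)}"

text \<open>Copies of F in the spanning subgraph of G with edge set H: subgraphs (W, D)
  of (V, H) isomorphic to F.\<close>
definition copies :: "'a set \<Rightarrow> 'a set set \<Rightarrow> nat \<Rightarrow> nat list set set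
     \<Rightarrow> (nat list set \<times> nat list set set) set" where
  "copies VF EF n H = {(f ` VF, (\<lambda>e. f ` e) ` EF) | f.
      inj_on f VF \<and> f ` VF \<subseteq> dg_V n \<and> (\<lambda>e. f ` e) ` EF \<subseteq> H}"

definition X_F :: "'a set \<Rightarrow> 'a set set \<Rightarrow> nat \<Rightarrow> nat list set set \<Rightarrow> real" where
  "X_F VF EF n H = real (card (copies VF EF n H))"

definition p_star :: "'a set \<Rightarrow> 'a set set \<Rightarrow> nat \<Rightarrow> real" where
  "p_star VF EF n = dg_N n powr (- 1 / rho_max VF EF) * sqrt (ln (dg_N n))"

end

theory Submission
  imports Defs "HOL-Real_Asymp.Real_Asymp"
begin

text \<open>
  Read as \<open>n\<close> columns in \<open>Pow V\<close>, a homomorphism from a graph \<open>(V, E)\<close> with \<open>k\<close> vertices and \<open>e\<close> edges into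
  the distance graph is a sequence of letters with \<open>k + e\<close> prescribed superset counts. Counting such
  sequences with multinomial coefficients and Stirling's formula shows that their number is of order
  \<open>2\<^bsup>nk\<^esup> / n\<^bsup>(k+e)/2\<^esup>\<close>, that is \<open>N\<^bsup>k\<^esup> / n\<^bsup>e/2\<^esup>\<close>. So, up to constants, \<open>G\<^sub>p\<close> contains as many copies of
  fixed graphs as the binomial random graph on \<open>N\<close> vertices with edge probability \<open>p / \<surd>n\<close>, where
  \<open>n\<close> is of order \<open>ln N\<close>. The theorem then follows from the first moment method for a densest subgraph and
  Chebyshev's inequality, where pairs of copies are classified by their overlap.
\<close>

section \<open>Bounds for multinomial coefficients\<close>

text \<open>The obstacle is precision: the number of homomorphisms must be right up to a constant,
  since an error by a power of \<open>n\<close> would move the threshold by a power of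
  \<open>ln N\<close>. Both bounds are therefore local limit estimates, in which every constraint
  costs exactly one factor \<open>sqrt n\<close>. With \<open>d\<close> constraints, the upper bound
  freezes all but \<open>d + 1\<close> letters, so that only one vector of multiplicities remains
  possible; the lower bound lets the other multiplicities range over windows of width about
  \<open>sqrt n\<close>. The upper bound must be uniform over all graphs of bounded size, because
  the variance applies it to unions of two copies, and these change with \<open>n\<close>. Both
  moments are governed by \<open>y = N powr (1 / \<rho>) * (p / sqrt n)\<close>, where
  \<open>\<rho>\<close> is the maximal density: the expected number of copies of a densest subgraph
  is at most a constant times a positive power of \<open>y\<close>, and overlaps with
  \<open>i\<close> vertices and \<open>j\<close> edges, where \<open>j \<le> \<rho> * i\<close>,
  contribute at most order \<open>1 / y ^ j\<close> relative to the squared mean.\<close>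

lemma fact_upper_Stirling:
  fixes n :: nat
  assumes "n \<ge> 1"
  shows "fact n \<le> exp 1 * sqrt n * (n / exp 1) ^ n"
  using assms
proof (induction n rule: dec_induct)
  case base
  then show ?case by simp
next
  case (step n)
  \<comment> \<open>The midpoint bound for the logarithm is exactly what makes
    \<open>exp 1 * sqrt n * (n / exp 1) ^ n\<close> grow by at least the factor \<open>n + 1\<close>
    in each step.\<close>
  have "1 \<le> (n + 1/2) * (ln (real n + 1) - ln n)"
    using ln_inverse_approx_ge[of "real n" "real n + 1"] step.hyps by (simp add: field_simps)
  then have "exp 1 \<le> exp ((n + 1/2) * (ln (real n + 1) - ln n))"
    by simp
  also have "\<dots> = ((real n + 1) / n) powr (n + 1/2)"
    using step.hyps by (simp add: powr_def ln_div)
  also have "\<dots> = ((real n + 1) / n) ^ n * (sqrt (real n + 1) / sqrt n)"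
    using step.hyps by (simp add: powr_add powr_realpow powr_half_sqrt real_sqrt_divide)
  finally have *: "exp 1 * sqrt n * n ^ n \<le> (real n + 1) ^ n * sqrt (real n + 1)"
    using step.hyps by (simp add: field_simps power_divide)
  have "fact (Suc n) \<le> (n + 1) * (exp 1 * sqrt n * (n / exp 1) ^ n)"
    using step.IH by (simp add: mult_left_mono)
  also have "\<dots> = (n + 1) * (exp 1 * sqrt n * n ^ n) / exp 1 ^ n"
    by (simp add: power_divide)
  also have "\<dots> \<le> (n + 1) * ((real n + 1) ^ n * sqrt (real n + 1)) / exp 1 ^ n"
    by (intro divide_right_mono mult_left_mono *) auto
  also have "\<dots> = exp 1 * sqrt (Suc n) * (Suc n / exp 1) ^ Suc n"
    by (simp add: power_divide add.commute)
  finally show ?case .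
qed

text \<open>The induction carries an extra factor \<open>exp (3/4 + 1 / (4 * n))\<close>, always at
  least 1 and equal to \<open>exp 1\<close> at \<open>n = 1\<close>, where equality holds. The
  trapezoidal bound for the logarithm overshoots the exponent 1 by \<open>a\<close>, and these
  errors telescope into the extra factor.\<close>

lemma fact_lower_Stirling:
  fixes n :: nat
  assumes "n \<ge> 1"
  shows "sqrt n * (n / exp 1) ^ n \<le> fact n"
proof -
  have "exp (3/4 + 1 / (4 * n)) * (sqrt n * (n / exp 1) ^ n) \<le> fact n"
    using assms
  proof (induction n rule: dec_induct)
    case base
    then show ?case by simp
  next
    case (step n)
    define a where "a = 1 / (4 * real n) - 1 / (4 * (real n + 1))"
    have n: "n > 0" using step.hyps by simp
    have "(n + 1/2) * (ln (real n + 1) - ln n)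
        \<le> (n + 1/2) * ((inverse (real n) + inverse (real n + 1)) / 2)"
      using ln_inverse_approx_le[of "real n" 1] n by (intro mult_left_mono) auto
    also have "\<dots> = 1 + a"
      using n by (simp add: divide_simps a_def) (simp add: algebra_simps)
    finally have "exp ((n + 1/2) * (ln (real n + 1) - ln n)) \<le> exp (1 + a)"
      by simp
    also have "exp ((n + 1/2) * (ln (real n + 1) - ln n)) = ((real n + 1) / n) powr (n + 1/2)"
      using n by (simp add: powr_def ln_div)
    also have "\<dots> = ((real n + 1) / n) ^ n * (sqrt (real n + 1) / sqrt n)"
      using n by (simp add: powr_add powr_realpow powr_half_sqrt real_sqrt_divide)
    finally have *: "(real n + 1) ^ n * sqrt (real n + 1) \<le> exp (1 + a) * sqrt n * n ^ n"
      using n by (simp add: field_simps power_divide)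
    have "exp (3/4 + 1 / (4 * Suc n)) * (sqrt (Suc n) * (Suc n / exp 1) ^ Suc n)
        = exp (3/4 + 1 / (4 * Suc n)) * (n + 1) / exp 1 ^ Suc n * ((real n + 1) ^ n * sqrt (real n + 1))"
      by (simp add: power_divide add.commute)
    also have "\<dots> \<le> exp (3/4 + 1 / (4 * Suc n)) * (n + 1) / exp 1 ^ Suc n * (exp (1 + a) * sqrt n * n ^ n)"
      by (intro mult_left_mono *) auto
    also have "\<dots> = (n + 1) * ((exp (3/4 + 1 / (4 * Suc n)) * exp a) * (sqrt n * (n / exp 1) ^ n))"
      by (simp add: power_divide exp_add)
    also have "exp (3/4 + 1 / (4 * Suc n)) * exp a = exp (3/4 + 1 / (4 * n))"
      by (simp flip: exp_add add: a_def add.commute)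
    also have "(n + 1) * (exp (3/4 + 1 / (4 * n)) * (sqrt n * (n / exp 1) ^ n)) \<le> real (n + 1) * fact n"
      by (intro mult_left_mono step.IH) auto
    also have "\<dots> = fact (Suc n)" by simp
    finally show ?case .
  qed
  moreover have "1 * (sqrt n * (n / exp 1) ^ n) \<le> exp (3/4 + 1 / (4 * n)) * (sqrt n * (n / exp 1) ^ n)"
    by (intro mult_right_mono) auto
  ultimately show ?thesis by linarith
qed

text \<open>As a function of \<open>m\<close>, \<open>fact m / (a + 1) ^ m\<close> has successive
  ratios \<open>(m + 1) / (a + 1)\<close>, hence a minimum at \<open>m = a\<close>. Multiplied over
  all letters, this shows that balanced multiplicities minimise the product of factorials, without
  any exchange argument.\<close>

lemma fact_ge_fact_mult_power:
  fixes a m :: nat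
  shows "(fact a * (a + 1) ^ m :: nat) \<le> fact m * (a + 1) ^ a"
proof (cases "a \<le> m")
  case True
  then obtain j where "m = a + j" using le_Suc_ex by blast
  moreover have "fact a * (a + 1) ^ j \<le> (fact (a + j) :: nat)"
  proof (induction j)
    case (Suc j)
    have "(a + 1) * (fact a * (a + 1) ^ j) \<le> (a + j + 1) * (fact (a + j) :: nat)"
      by (intro mult_mono Suc) auto
    then show ?case by (simp add: algebra_simps)
  qed simp
  ultimately show ?thesis
    by (simp add: power_add mult.assoc mult.left_commute)
next
  case False
  then obtain j where "a = m + j" using le_Suc_ex nat_le_linear by blast
  moreover have "fact (m + j) \<le> (fact m * (m + j + 1) ^ j :: nat)"
  proof -
    have "fact (m + i) \<le> (fact m * (m + j + 1) ^ i :: nat)" if "i \<le> j" for i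
      using that
    proof (induction i)
      case (Suc i)
      then have "(m + i + 1) * fact (m + i) \<le> (m + j + 1) * (fact m * (m + j + 1) ^ i :: nat)"
        by (intro mult_mono) auto
      then show ?case by (simp add: algebra_simps)
    qed simp
    then show ?thesis by simp
  qed
  ultimately show ?thesis
    by (simp add: power_add mult.assoc mult.left_commute)
qed

text \<open>With \<open>u = a (d+1) + r\<close>, the previous lemma shows that the multinomial coefficient is at most
  the balanced value \<open>u! / (a!\<^sup>d\<^sup>+\<^sup>1 (a+1)\<^sup>r)\<close>.\<close>
lemma multinomial_le:
  fixes m :: "'b \<Rightarrow> nat"
  assumes B: "finite B" "card B = Suc d" and u: "u = sum m B"
  shows "fact u \<le> exp 1 * sqrt (2 * Suc d) ^ Suc d * Suc d ^ u / sqrt (u + 1) ^ d * (\<Prod>i\<in>B. fact (m i))"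
proof -
  define b where "b = Suc d"
  define a where "a = u div b"
  define r where "r = u mod b"
  have b: "b > 0" by (simp add: b_def)
  then have ur: "u = a * b + r" "r < b" unfolding a_def r_def by simp_all
  have "(\<Prod>i\<in>B. fact a * (a + 1) ^ m i) \<le> (\<Prod>i\<in>B. fact (m i) * (a + 1) ^ a)"
    using fact_ge_fact_mult_power by (intro prod_mono) auto
  then have "fact a ^ b * (a + 1) ^ u \<le> (\<Prod>i\<in>B. fact (m i)) * ((a + 1) ^ (a * b))"
    using B by (simp only: prod.distrib u power_sum b_def power_mult prod_constant)
  then have "(fact a ^ b * (a + 1) ^ r) * (a + 1) ^ (a * b) \<le> (\<Prod>i\<in>B. fact (m i)) * ((a + 1) ^ (a * b))"
    by (simp add: ur power_add mult.commute mult.left_commute)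
  then have "fact a ^ b * (a + 1) ^ r \<le> (\<Prod>i\<in>B. fact (m i))"
    by (subst (asm) mult_le_cancel2) auto
  then have "real (fact a ^ b * (a + 1) ^ r) \<le> real (\<Prod>i\<in>B. fact (m i))"
    by (rule of_nat_mono)
  then have P: "fact a ^ b * (real a + 1) ^ r \<le> (\<Prod>i\<in>B. fact (m i))"
    by (simp add: add.commute)
  have "fact u \<le> exp 1 * sqrt (2 * b) ^ b * b ^ u / sqrt (u + 1) ^ d * (fact a ^ b * (real a + 1) ^ r)"
  proof (cases "a = 0")
    case True
    then have ub: "u < b" using ur by simp
    have "sqrt (u + 1) ^ d \<le> sqrt (2 * b) ^ d"
      using ub by (intro power_mono real_sqrt_le_mono) auto
    also have "\<dots> \<le> exp 1 * sqrt (2 * b) ^ b"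
      using b mult_mono[of 1 "exp 1 * sqrt (2 * b)" "sqrt (2*b) ^ d" "sqrt (2*b) ^ d"]
        mult_mono[of 1 "exp 1::real" 1 "sqrt (2 * b)"]
      by (auto simp: b_def)
    finally have 1: "sqrt (u + 1) ^ d \<le> exp 1 * sqrt (2 * b) ^ b" .
    have "fact u \<le> real u ^ u" using fact_le_power[of u, where 'a = real] by simp
    also have "\<dots> \<le> real b ^ u" using ub by (intro power_mono) auto
    also have "\<dots> \<le> (exp 1 * sqrt (2 * b) ^ b / sqrt (u + 1) ^ d) * b ^ u"
      using 1 mult_right_mono[of 1 "exp 1 * sqrt (2 * b) ^ b / sqrt (u + 1) ^ d" "real b ^ u"]
      by (simp add: field_simps)
    finally show ?thesis using True by (simp add: field_simps)
  next
    case False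
    then have a: "a \<ge> 1" by simp
    have "a \<le> a * b" using b by simp
    then have u1: "u \<ge> 1" using ur(1) a by linarith
    have ub: "u + 1 \<le> b * (a + 1)" using ur by (simp add: algebra_simps)
    \<comment> \<open>The remainder \<open>r\<close> enlarges the main power by at most
      \<open>exp r\<close>, which cancels against the same factor of \<open>exp 1 ^ u\<close> in
      \<open>E\<close> below.\<close>
    have "- real (a * b) \<le> real r"
      by (rule order_trans[of _ 0]) auto
    then have e: "(1 + r / (a * b)) ^ (a * b) \<le> exp r"
      using exp_ge_one_plus_x_over_n_power_n[of "a * b" "real r"] a b by simp
    have uab: "real u / a = b * (1 + r / (a * b))" using ur a b by (simp add: field_simps)
    have "real u ^ (a * b) = a ^ (a * b) * (real u / a) ^ (a * b)"
      using a by (simp add: power_divide)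
    also have "(real u / a) ^ (a * b) = b ^ (a * b) * (1 + r / (a * b)) ^ (a * b)"
      by (simp only: uab power_mult_distrib of_nat_power)
    also have "\<dots> \<le> b ^ (a * b) * exp r" by (intro mult_left_mono e) auto
    finally have A: "real u ^ (a * b) \<le> a ^ (a * b) * (b ^ (a * b) * exp r)" by (simp add: mult_left_mono)
    have "real u \<le> real b * (real a + 1)"
      using of_nat_mono[OF ub, where 'a = real] by (simp add: algebra_simps)
    then have "real u ^ r \<le> (real b * (real a + 1)) ^ r"
      by (intro power_mono) auto
    then have R: "real u ^ r \<le> b ^ r * (real a + 1) ^ r"
      by (simp add: power_mult_distrib)
    have "sqrt (u + 1) \<le> sqrt (2 * b * a)"
    proof (rule real_sqrt_le_mono)
      have "b * (a + 1) \<le> b * (2 * a)" using a by (intro mult_le_mono2) auto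
      with ub have "u + 1 \<le> b * (2 * a)" by (rule order_trans)
      then have "u + 1 \<le> 2 * b * a" by (simp only: ac_simps)
      then show "real (u + 1) \<le> 2 * b * a" using of_nat_mono by fastforce
    qed
    then have sq: "sqrt (u + 1) \<le> sqrt (2 * b) * sqrt a" by (simp add: real_sqrt_mult)
    have "sqrt u * sqrt (u + 1) ^ d \<le> sqrt (u + 1) ^ b"
      by (simp add: b_def mult_right_mono)
    also have "\<dots> \<le> (sqrt (2 * b) * sqrt a) ^ b" using sq by (intro power_mono) auto
    finally have S: "sqrt u * sqrt (u + 1) ^ d \<le> sqrt (2 * b) ^ b * sqrt a ^ b"
      by (simp add: power_mult_distrib)
    have L: "(sqrt a * (a / exp 1) ^ a) ^ b \<le> fact a ^ b"
      using fact_lower_Stirling[OF a] by (intro power_mono) auto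
    have E: "exp 1 ^ u = (exp 1 ^ (a * b)) * exp (real r)"
      by (simp add: ur power_add flip: exp_of_nat_mult)
    have bu: "real b ^ u = real b ^ (a * b) * real b ^ r"
      by (simp add: ur power_add)
    have F: "(sqrt a * (a / exp 1) ^ a) ^ b = sqrt a ^ b * (real a ^ (a * b) / exp 1 ^ (a * b))"
      by (simp only: power_mult_distrib power_mult[symmetric] power_divide)
    have "fact u * sqrt (u + 1) ^ d \<le> exp 1 * sqrt u * (u / exp 1) ^ u * sqrt (u + 1) ^ d"
      using fact_upper_Stirling[OF u1] by (intro mult_right_mono) auto
    also have "\<dots> = exp 1 * (sqrt u * sqrt (u + 1) ^ d) * (real u ^ (a * b) * real u ^ r) / exp 1 ^ u"
      by (simp add: power_divide ur power_add)
    also have "\<dots> \<le> exp 1 * (sqrt (2 * b) ^ b * sqrt a ^ b)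
        * ((a ^ (a * b) * (b ^ (a * b) * exp r)) * (b ^ r * (real a + 1) ^ r)) / exp 1 ^ u"
      by (intro divide_right_mono mult_mono A R S mult_nonneg_nonneg) auto
    also have "\<dots> = exp 1 * sqrt (2 * b) ^ b * b ^ u * ((sqrt a * (a / exp 1) ^ a) ^ b * (real a + 1) ^ r)"
      by (simp add: E bu F)
    also have "\<dots> \<le> exp 1 * sqrt (2 * b) ^ b * b ^ u * (fact a ^ b * (real a + 1) ^ r)"
      by (intro mult_left_mono mult_right_mono L) auto
    finally show ?thesis by (simp add: field_simps)
  qed
  also have "\<dots> \<le> exp 1 * sqrt (2 * b) ^ b * b ^ u / sqrt (u + 1) ^ d * (\<Prod>i\<in>B. fact (m i))"
    by (intro mult_left_mono P) auto
  finally show ?thesis by (simp add: b_def)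
qed

text \<open>The Gaussian factor comes from \<open>m\<^sup>m \<le> \<mu>\<^sup>m exp (m (m/\<mu> - 1))\<close>, where the exponents sum up
  to \<open>\<Sum> (m - \<mu>)\<^sup>2 / \<mu>\<close>.\<close>
lemma multinomial_ge:
  fixes m :: "'b \<Rightarrow> nat"
  assumes B: "finite B" "card B = q" "q \<ge> 1" and n: "n = sum m B" "n \<ge> 1"
    and K: "\<And>i. i \<in> B \<Longrightarrow> \<bar>m i - n / q\<bar> \<le> K * sqrt n"
  shows "exp (- real q - q\<^sup>2 * K\<^sup>2) * q ^ n * sqrt n / sqrt n ^ q * (\<Prod>i\<in>B. fact (m i)) \<le> fact n"
proof -
  define \<mu> where "\<mu> = real n / q"
  have \<mu>: "\<mu> > 0" using B(3) n(2) unfolding \<mu>_def by simp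
  have le: "m i \<le> n" if "i \<in> B" for i
    using n B that by (simp add: member_le_sum)
  have f: "fact (m i) \<le> exp 1 * sqrt n * (\<mu> ^ m i * exp (m i * (m i / \<mu> - 1))) / exp 1 ^ m i" if "i \<in> B" for i
  proof (cases "m i = 0")
    case True
    have "1 * 1 \<le> exp 1 * sqrt n" using n(2) by (intro mult_mono) simp_all
    then show ?thesis using True by simp
  next
    case False
    have "m i / \<mu> \<le> exp (m i / \<mu> - 1)"
      using exp_ge_add_one_self[of "m i / \<mu> - 1"] by simp
    then have "(m i / \<mu>) ^ m i \<le> exp (m i / \<mu> - 1) ^ m i"
      using \<mu> by (intro power_mono) auto
    then have "m i ^ m i / \<mu> ^ m i \<le> exp (m i * (m i / \<mu> - 1))"
      by (simp only: power_divide exp_of_nat_mult of_nat_power)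
    then have *: "m i ^ m i \<le> \<mu> ^ m i * exp (m i * (m i / \<mu> - 1))"
      using \<mu> by (simp add: pos_divide_le_eq mult.commute)
    have "fact (m i) \<le> exp 1 * sqrt (m i) * m i ^ m i / exp 1 ^ m i"
      using fact_upper_Stirling[of "m i"] False by (simp add: power_divide)
    also have "\<dots> \<le> exp 1 * sqrt n * (\<mu> ^ m i * exp (m i * (m i / \<mu> - 1))) / exp 1 ^ m i"
      using * le[OF that] \<mu> by (intro divide_right_mono mult_mono) auto
    finally show ?thesis .
  qed
  \<comment> \<open>The linear terms \<open>m i - \<mu>\<close> sum to zero because
    \<open>n = q * \<mu>\<close>, which leaves only squared deviations.\<close>
  have "(\<Sum>i\<in>B. m i * (m i / \<mu> - 1)) = (\<Sum>i\<in>B. (m i - \<mu>)\<^sup>2 / \<mu> + (m i - \<mu>))"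
    using \<mu> by (intro sum.cong) (auto simp: field_simps power2_eq_square)
  also have "\<dots> = (\<Sum>i\<in>B. (m i - \<mu>)\<^sup>2) / \<mu> + (real (sum m B) - q * \<mu>)"
    using B by (simp add: sum.distrib sum_divide_distrib sum_subtractf)
  also have "\<dots> = (\<Sum>i\<in>B. (m i - \<mu>)\<^sup>2) / \<mu>"
    using B by (simp add: \<mu>_def n)
  also have "\<dots> \<le> (\<Sum>i\<in>B. (K * sqrt n)\<^sup>2) / \<mu>"
  proof (intro divide_right_mono sum_mono)
    fix i assume "i \<in> B"
    then have "\<bar>m i - \<mu>\<bar> \<le> \<bar>K * sqrt n\<bar>" using K unfolding \<mu>_def by fastforce
    then show "(m i - \<mu>)\<^sup>2 \<le> (K * sqrt n)\<^sup>2" by (simp only: abs_le_square_iff)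
  qed (use \<mu> in auto)
  also have "\<dots> = q\<^sup>2 * K\<^sup>2"
    using B(2,3) n(2) by (simp add: \<mu>_def power_mult_distrib) (simp add: power2_eq_square)
  finally have S: "(\<Sum>i\<in>B. m i * (m i / \<mu> - 1)) \<le> q\<^sup>2 * K\<^sup>2" .
  have "(\<Prod>i\<in>B. fact (m i)) \<le> (\<Prod>i\<in>B. exp 1 * sqrt n * (\<mu> ^ m i * exp (m i * (m i / \<mu> - 1))) / exp 1 ^ m i)"
    using f by (intro prod_mono) auto
  also have "\<dots> = exp q * sqrt n ^ q * (\<mu> ^ n * exp (\<Sum>i\<in>B. m i * (m i / \<mu> - 1))) / exp 1 ^ n"
    using B by (simp only: prod.distrib prod_dividef n power_sum exp_sum prod_constant
        power_mult_distrib exp_of_nat_mult[of _ 1, symmetric] mult_1_right)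
  also have "\<dots> \<le> exp q * sqrt n ^ q * (\<mu> ^ n * exp (q\<^sup>2 * K\<^sup>2)) / exp 1 ^ n"
    using S \<mu> by (intro divide_right_mono mult_left_mono) auto
  finally have "exp (- real q - q\<^sup>2 * K\<^sup>2) * q ^ n * sqrt n / sqrt n ^ q * (\<Prod>i\<in>B. fact (m i))
     \<le> exp (- real q - q\<^sup>2 * K\<^sup>2) * q ^ n * sqrt n / sqrt n ^ q * (exp q * sqrt n ^ q * (\<mu> ^ n * exp (q\<^sup>2 * K\<^sup>2)) / exp 1 ^ n)"
    by (intro mult_left_mono) auto
  also have "\<dots> = (exp (- real q - q\<^sup>2 * K\<^sup>2) * exp q * exp (q\<^sup>2 * K\<^sup>2)) * sqrt n * (n / exp 1) ^ n"
    using n(2) B(3) by (simp add: \<mu>_def power_divide)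
  also have "exp (- real q - q\<^sup>2 * K\<^sup>2) * exp q * exp (q\<^sup>2 * K\<^sup>2) = 1"
    by (simp flip: exp_add)
  also have "1 * sqrt n * (n / exp 1) ^ n \<le> fact n"
    using fact_lower_Stirling[OF n(2)] by simp
  finally show ?thesis by simp
qed

text \<open>Induction on the alphabet: a sequence with a further letter \<open>A\<close> is a choice
  of its positions \<open>X\<close> together with a sequence over the old letters on
  \<open>U - X\<close>. The product form of the multinomial coefficient avoids division in
  \<open>nat\<close>.\<close>

lemma card_functions_of_type:
  fixes m :: "'b \<Rightarrow> nat"
  assumes "finite T" "finite (U :: 'a set)" "sum m T = card U"
  shows "card {c \<in> U \<rightarrow>\<^sub>E T. \<forall>A\<in>T. card {t \<in> U. c t = A} = m A} * (\<Prod>A\<in>T. fact (m A)) = fact (card U)"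
  using assms
proof (induction T arbitrary: U rule: finite_induct)
  case empty
  then show ?case by simp
next
  case (insert A T)
  define Q where "Q = (\<lambda>(U :: 'a set) T. {c \<in> U \<rightarrow>\<^sub>E T. \<forall>A\<in>T. card {t \<in> U. c t = A} = m A})"
  define XX where "XX = {X. X \<subseteq> U \<and> card X = m A}"
  have fin: "finite XX" using insert.prems by (simp add: XX_def)
  have finQ: "finite (Q (U - X) T)" for X
    using insert.prems insert.hyps by (intro finite_subset[OF _ finite_PiE[of "U - X" "\<lambda>_. T"]]) (auto simp: Q_def)
  have "bij_betw (\<lambda>c. ({t \<in> U. c t = A}, restrict c (U - {t \<in> U. c t = A})))
      (Q U (insert A T)) (SIGMA X:XX. Q (U - X) T)"
  proof (rule bij_betw_byWitness[where f' = "\<lambda>(X, c) t. if t \<in> X then A else c t"])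
    show "\<forall>c\<in>Q U (insert A T).
       (case ({t \<in> U. c t = A}, restrict c (U - {t \<in> U. c t = A})) of (X, c) \<Rightarrow> \<lambda>t. if t \<in> X then A else c t) = c"
      by (auto simp: Q_def fun_eq_iff PiE_def extensional_def)
    show "\<forall>x\<in>SIGMA X:XX. Q (U - X) T.
       ({t \<in> U. (case x of (X, c) \<Rightarrow> \<lambda>t. if t \<in> X then A else c t) t = A},
        restrict (case x of (X, c) \<Rightarrow> \<lambda>t. if t \<in> X then A else c t)
         (U - {t \<in> U. (case x of (X, c) \<Rightarrow> \<lambda>t. if t \<in> X then A else c t) t = A})) = x"
    proof
      fix x assume "x \<in> (SIGMA X:XX. Q (U - X) T)"
      then obtain X c where x: "x = (X, c)" and X: "X \<in> XX" and c: "c \<in> Q (U - X) T" by blast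
      have "t \<in> U \<and> t \<notin> X \<Longrightarrow> c t \<noteq> A" for t
        using c insert.hyps by (auto simp: Q_def)
      then have 1: "{t \<in> U. (if t \<in> X then A else c t) = A} = X"
        using X by (auto simp: XX_def)
      show "({t \<in> U. (case x of (X, c) \<Rightarrow> \<lambda>t. if t \<in> X then A else c t) t = A},
        restrict (case x of (X, c) \<Rightarrow> \<lambda>t. if t \<in> X then A else c t)
         (U - {t \<in> U. (case x of (X, c) \<Rightarrow> \<lambda>t. if t \<in> X then A else c t) t = A})) = x"
        using c unfolding x prod.case 1 by (auto simp: Q_def fun_eq_iff PiE_def extensional_def)
    qed
    show "(\<lambda>c. ({t \<in> U. c t = A}, restrict c (U - {t \<in> U. c t = A}))) ` Q U (insert A T) \<subseteq> (SIGMA X:XX. Q (U - X) T)"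
    proof (rule image_subsetI)
      fix c assume c: "c \<in> Q U (insert A T)"
      have "{t \<in> U. c t = A} \<in> XX" using c by (auto simp: XX_def Q_def)
      have "{t \<in> U - {t \<in> U. c t = A}. restrict c (U - {t \<in> U. c t = A}) t = A'} = {t \<in> U. c t = A'}"
        if "A' \<in> T" for A' using that insert.hyps by auto
      then have "restrict c (U - {t \<in> U. c t = A}) \<in> Q (U - {t \<in> U. c t = A}) T"
        using c by (auto simp: Q_def)
      with \<open>{t \<in> U. c t = A} \<in> XX\<close>
      show "({t \<in> U. c t = A}, restrict c (U - {t \<in> U. c t = A})) \<in> (SIGMA X:XX. Q (U - X) T)"
        by simp
    qed
    show "(\<lambda>(X, c) t. if t \<in> X then A else c t) ` (SIGMA X:XX. Q (U - X) T) \<subseteq> Q U (insert A T)"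
    proof clarsimp
      fix X c assume X: "X \<in> XX" and c: "c \<in> Q (U - X) T"
      have "t \<in> U \<and> t \<notin> X \<Longrightarrow> c t \<noteq> A" for t
        using c insert.hyps by (auto simp: Q_def)
      then have 1: "{t \<in> U. (if t \<in> X then A else c t) = A} = X"
        using X by (auto simp: XX_def)
      have 2: "{t \<in> U. (if t \<in> X then A else c t) = A'} = {t \<in> U - X. c t = A'}" if "A' \<in> T" for A'
        using that insert.hyps by auto
      show "(\<lambda>t. if t \<in> X then A else c t) \<in> Q U (insert A T)"
        using X c 1 2 by (auto simp: Q_def XX_def PiE_def extensional_def Pi_def)
    qed
  qed
  then have "card (Q U (insert A T)) = card (SIGMA X:XX. Q (U - X) T)"
    by (rule bij_betw_same_card)
  also have "\<dots> = (\<Sum>X\<in>XX. card (Q (U - X) T))"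
    using fin finQ by (simp add: card_SigmaI)
  finally have "card (Q U (insert A T)) * (\<Prod>A\<in>T. fact (m A)) = (\<Sum>X\<in>XX. card (Q (U - X) T) * (\<Prod>A\<in>T. fact (m A)))"
    by (simp add: sum_distrib_right)
  also have "\<dots> = (\<Sum>X\<in>XX. fact (card U - m A))"
  proof (rule sum.cong)
    fix X assume "X \<in> XX"
    then have "card (U - X) = card U - m A" "finite (U - X)"
      using insert.prems by (auto simp: XX_def card_Diff_subset finite_subset)
    then show "card (Q (U - X) T) * (\<Prod>A\<in>T. fact (m A)) = fact (card U - m A)"
      using insert.IH[of "U - X"] insert.prems insert.hyps unfolding Q_def by simp
  qed simp
  also have "\<dots> = (card U choose m A) * fact (card U - m A)"
    using insert.prems by (simp add: XX_def n_subsets)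
  finally have "card (Q U (insert A T)) * (\<Prod>A\<in>insert A T. fact (m A))
     = fact (m A) * fact (card U - m A) * (card U choose m A)"
    using insert.hyps by (simp add: algebra_simps)
  also have "\<dots> = fact (card U)"
    using insert.prems insert.hyps by (intro binomial_fact_lemma) simp
  finally show ?case unfolding Q_def .
qed

section \<open>Weighted sums over subsets with inverse powers of the size\<close>

lemma sum_Pow_card:
  fixes f :: "nat \<Rightarrow> real"
  assumes "finite A"
  shows "(\<Sum>U\<in>Pow A. f (card U)) = (\<Sum>u\<le>card A. (card A choose u) * f u)"
proof -
  have "(\<Sum>U\<in>Pow A. f (card U)) = (\<Sum>u\<le>card A. \<Sum>U | U \<in> Pow A \<and> card U = u. f (card U))"
    using assms by (intro sum.group[symmetric]) (auto intro: card_mono)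
  also have "\<dots> = (\<Sum>u\<le>card A. (card A choose u) * f u)"
    using assms by (intro sum.cong) (auto simp: n_subsets)
  finally show ?thesis .
qed

text \<open>The identity \<open>(n choose u) / (u + 1) = (Suc n choose Suc u) / (n + 1)\<close>
  trades one inverse power of \<open>u + 1\<close> for the factor \<open>1 / (b * (n + 1))\<close>
  and a larger \<open>n\<close>; hence the induction with arbitrary \<open>n\<close>. Replacing
  \<open>u + 1\<close> by \<open>u + 2\<close> in the remaining powers costs \<open>2 ^ d\<close>,
  and these costs accumulate to at most \<open>2 ^ (d\<^sup>2)\<close>.\<close>

lemma binomial_sum_inverse_power_le:
  fixes a b :: real
  assumes "a \<ge> 0" "b > 0"
  shows "(\<Sum>u\<le>n. (n choose u) * (a ^ (n - u) * b ^ u / (real u + 1) ^ d))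
           \<le> 2 ^ (d\<^sup>2) * (a + b) ^ (n + d) / (b * (real n + 1)) ^ d"
proof (induction d arbitrary: n)
  case 0
  then show ?case by (simp add: binomial_ring[of b a n] mult_ac add.commute[of a b])
next
  case (Suc d)
  have "(\<Sum>u\<le>n. (n choose u) * (a ^ (n - u) * b ^ u / (real u + 1) ^ Suc d))
     \<le> (\<Sum>u\<le>n. 2 ^ d / (b * (real n + 1)) *
          ((Suc n choose Suc u) * (a ^ (Suc n - Suc u) * b ^ Suc u / (real (Suc u) + 1) ^ d)))"
  proof (rule sum_mono)
    fix u
    have 1: "(Suc n choose Suc u) = (n choose u) * (real n + 1) / (real u + 1)"
      using Suc_times_binomial_eq[of n u] by (simp add: field_simps flip: of_nat_Suc of_nat_mult)
    have "(real (Suc u) + 1) ^ d \<le> (2 * (real u + 1)) ^ d"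
      by (intro power_mono) auto
    then have "(real (Suc u) + 1) ^ d \<le> 2 ^ d * (real u + 1) ^ d"
      by (simp only: power_mult_distrib)
    then have "1 \<le> 2 ^ d * (real u + 1) ^ d / (real (Suc u) + 1) ^ d"
      by simp
    then have "(n choose u) * (a ^ (n - u) * b ^ u / (real u + 1) ^ Suc d) * 1 \<le>
       (n choose u) * (a ^ (n - u) * b ^ u / (real u + 1) ^ Suc d) * (2 ^ d * (real u + 1) ^ d / (real (Suc u) + 1) ^ d)"
      using assms by (intro mult_left_mono) auto
    also have "\<dots> = 2 ^ d / (b * (real n + 1)) *
          ((Suc n choose Suc u) * (a ^ (Suc n - Suc u) * b ^ Suc u / (real (Suc u) + 1) ^ d))"
      unfolding 1 using assms by simp
    finally show "(n choose u) * (a ^ (n - u) * b ^ u / (real u + 1) ^ Suc d) \<le> 2 ^ d / (b * (real n + 1)) *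
          ((Suc n choose Suc u) * (a ^ (Suc n - Suc u) * b ^ Suc u / (real (Suc u) + 1) ^ d))"
      by simp
  qed
  also have "\<dots> = 2 ^ d / (b * (real n + 1)) * (\<Sum>u\<le>n.
          ((Suc n choose Suc u) * (a ^ (Suc n - Suc u) * b ^ Suc u / (real (Suc u) + 1) ^ d)))"
    by (rule sum_distrib_left[symmetric])
  also have "\<dots> \<le> 2 ^ d / (b * (real n + 1)) *
      (\<Sum>u\<le>Suc n. (Suc n choose u) * (a ^ (Suc n - u) * b ^ u / (real u + 1) ^ d))"
    using assms by (intro mult_left_mono) (auto simp: sum.atMost_Suc_shift simp del: sum.atMost_Suc)
  also have "\<dots> \<le> 2 ^ d / (b * (real n + 1)) * (2 ^ (d\<^sup>2) * (a + b) ^ (Suc n + d) / (b * (real (Suc n) + 1)) ^ d)"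
    using assms by (intro mult_left_mono Suc.IH) auto
  also have "\<dots> \<le> 2 ^ d / (b * (real n + 1)) * (2 ^ (d\<^sup>2) * (a + b) ^ (Suc n + d) / (b * (real n + 1)) ^ d)"
    using assms by (intro mult_left_mono divide_left_mono power_mono) auto
  also have "\<dots> = 2 ^ (d + d\<^sup>2) * (a + b) ^ (n + Suc d) / (b * (real n + 1)) ^ Suc d"
    by (simp add: power_add)
  also have "\<dots> \<le> 2 ^ ((Suc d)\<^sup>2) * (a + b) ^ (n + Suc d) / (b * (real n + 1)) ^ Suc d"
    using assms by (intro divide_right_mono mult_right_mono power_increasing) (auto simp: power2_eq_square)
  finally show ?case .
qed

text \<open>The absorption identity handles integral powers only. Cauchy-Schwarz with the weights
  \<open>w U\<close> turns the exponent \<open>d / 2\<close> into \<open>d\<close>; its other factor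
  is the total weight \<open>(a + b) ^ n\<close>, so the square root has the right order.\<close>

lemma subset_sum_inverse_sqrt_power_le:
  fixes a b :: real
  assumes "a \<ge> 0" "b \<ge> 1" "n \<ge> 1"
  shows "(\<Sum>U\<in>Pow {..<n}. a ^ (n - card U) * b ^ card U / sqrt (real (card U) + 1) ^ d)
           \<le> 2 ^ (d\<^sup>2) * (a + b) ^ d * (a + b) ^ n / sqrt n ^ d"
proof -
  define w where "w = (\<lambda>U :: nat set. a ^ (n - card U) * b ^ card U)"
  define h where "h = (\<lambda>U :: nat set. 1 / sqrt (real (card U) + 1) ^ d)"
  have w: "w U \<ge> 0" for U using assms by (simp add: w_def)
  have "(\<Sum>U\<in>Pow {..<n}. w U * h U)\<^sup>2 = (\<Sum>U\<in>Pow {..<n}. sqrt (w U) * (sqrt (w U) * h U))\<^sup>2"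
    using w by (simp flip: mult.assoc)
  also have "\<dots> \<le> (\<Sum>U\<in>Pow {..<n}. (sqrt (w U))\<^sup>2) * (\<Sum>U\<in>Pow {..<n}. (sqrt (w U) * h U)\<^sup>2)"
    by (rule Cauchy_Schwarz_ineq_sum)
  also have "(\<Sum>U\<in>Pow {..<n}. (sqrt (w U))\<^sup>2) = (\<Sum>U\<in>Pow {..<n}. a ^ (n - card U) * b ^ card U)"
    using w by (simp add: w_def)
  also have "\<dots> = (a + b) ^ n"
    by (subst sum_Pow_card) (auto simp: binomial_ring[of b a n] add.commute[of a b] mult_ac)
  also have "(\<Sum>U\<in>Pow {..<n}. (sqrt (w U) * h U)\<^sup>2) =
     (\<Sum>U\<in>Pow {..<n}. a ^ (n - card U) * b ^ card U / (real (card U) + 1) ^ d)"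
  proof (intro sum.cong refl)
    fix U
    have "(sqrt (w U) * h U)\<^sup>2 = w U / sqrt (real (card U) + 1) ^ (2 * d)"
      using w by (simp add: h_def power_mult_distrib power_divide mult.commute[of 2] flip: power_mult)
    then show "(sqrt (w U) * h U)\<^sup>2 = a ^ (n - card U) * b ^ card U / (real (card U) + 1) ^ d"
      by (simp add: w_def power_mult)
  qed
  also have "\<dots> = (\<Sum>u\<le>n. (n choose u) * (a ^ (n - u) * b ^ u / (real u + 1) ^ d))"
    by (subst sum_Pow_card) auto
  also have "\<dots> \<le> 2 ^ (d\<^sup>2) * (a + b) ^ (n + d) / (b * (real n + 1)) ^ d"
    using assms by (intro binomial_sum_inverse_power_le) auto
  also have "\<dots> \<le> 2 ^ (d\<^sup>2) * (a + b) ^ (n + d) / real n ^ d"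
  proof (intro divide_left_mono power_mono)
    show "real n \<le> b * (real n + 1)"
      using assms mult_mono[of 1 b "real n" "real n + 1"] by simp
  qed (use assms in auto)
  finally have "(\<Sum>U\<in>Pow {..<n}. w U * h U)\<^sup>2 \<le> (a + b) ^ n * (2 ^ (d\<^sup>2) * (a + b) ^ (n + d) / real n ^ d)"
    using assms by (simp add: mult_left_mono)
  also have "\<dots> \<le> (2 ^ (d\<^sup>2))\<^sup>2 * ((a + b) ^ d)\<^sup>2 * ((a + b) ^ n)\<^sup>2 / real n ^ d"
  proof -
    have "1 * (a + b) ^ d \<le> 2 ^ (d\<^sup>2) * ((a + b) ^ d)\<^sup>2"
      using assms by (intro mult_mono) (auto intro!: self_le_power one_le_power)
    then have "(2 ^ (d\<^sup>2) * ((a + b) ^ n)\<^sup>2 / real n ^ d) * (a + b) ^ d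
       \<le> (2 ^ (d\<^sup>2) * ((a + b) ^ n)\<^sup>2 / real n ^ d) * (2 ^ (d\<^sup>2) * ((a + b) ^ d)\<^sup>2)"
      using assms by (intro mult_left_mono) auto
    then show ?thesis by (simp add: power_add power2_eq_square mult_ac)
  qed
  also have "\<dots> = (2 ^ (d\<^sup>2) * (a + b) ^ d * (a + b) ^ n / sqrt n ^ d)\<^sup>2"
    by (simp add: power_mult_distrib power_divide flip: power_mult) (simp add: power_mult mult.commute[of d])
  finally have "(\<Sum>U\<in>Pow {..<n}. w U * h U) \<le> 2 ^ (d\<^sup>2) * (a + b) ^ d * (a + b) ^ n / sqrt n ^ d"
    using assms by (elim power2_le_imp_le) auto
  then show ?thesis by (simp add: w_def h_def)
qed

section \<open>Column sequences with prescribed superset counts\<close>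

lemma card_superset_eq_sum:
  assumes "finite U" "finite B" "c \<in> U \<rightarrow> B"
  shows "card {t \<in> U. S \<subseteq> c t} = (\<Sum>A | A \<in> B \<and> S \<subseteq> A. card {t \<in> U. c t = A})"
proof -
  have "{t \<in> U. S \<subseteq> c t} = (\<Union>A\<in>{A \<in> B. S \<subseteq> A}. {t \<in> U. c t = A})"
    using assms by auto
  also have "card \<dots> = (\<Sum>A | A \<in> B \<and> S \<subseteq> A. card {t \<in> U. c t = A})"
    using assms by (intro card_UN_disjoint) auto
  finally show ?thesis .
qed

text \<open>The system is triangular with respect to inclusion: at a largest set where
  \<open>m\<close> and \<open>m'\<close> differ, all proper supersets in \<open>B\<close> agree, and
  the equation of that set forces agreement there too.\<close>

lemma superset_sums_inj:
  fixes m m' :: "'v set \<Rightarrow> nat"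
  assumes B: "finite B" "\<And>A. A \<in> B \<Longrightarrow> finite A"
    and eq: "\<And>S. S \<in> B \<Longrightarrow> (\<Sum>A | A \<in> B \<and> S \<subseteq> A. m A) = (\<Sum>A | A \<in> B \<and> S \<subseteq> A. m' A)"
    and "S \<in> B"
  shows "m S = m' S"
proof (rule ccontr)
  assume "m S \<noteq> m' S"
  define D where "D = {A \<in> B. m A \<noteq> m' A}"
  have D: "finite D" "D \<noteq> {}" using B \<open>S \<in> B\<close> \<open>m S \<noteq> m' S\<close> by (auto simp: D_def)
  have "Max (card ` D) \<in> card ` D" using D by (intro Max_in) auto
  then obtain S0 where "S0 \<in> D" "card S0 = Max (card ` D)" by auto
  then have S0: "S0 \<in> D" "\<And>A. A \<in> D \<Longrightarrow> card A \<le> card S0"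
    using D by auto
  have "m A = m' A" if "A \<in> B" "S0 \<subseteq> A" "A \<noteq> S0" for A
    using S0(2)[of A] psubset_card_mono[of A S0] that B by (force simp: D_def)
  then have "(\<Sum>A\<in>{A \<in> B. S0 \<subseteq> A} - {S0}. m A) = (\<Sum>A\<in>{A \<in> B. S0 \<subseteq> A} - {S0}. m' A)"
    by (intro sum.cong) auto
  moreover have "(\<Sum>A | A \<in> B \<and> S0 \<subseteq> A. m A) = m S0 + (\<Sum>A\<in>{A \<in> B. S0 \<subseteq> A} - {S0}. m A)"
    "(\<Sum>A | A \<in> B \<and> S0 \<subseteq> A. m' A) = m' S0 + (\<Sum>A\<in>{A \<in> B. S0 \<subseteq> A} - {S0}. m' A)"
    using S0 B by (auto simp: D_def intro!: sum.remove)
  moreover have "S0 \<in> B" "m S0 \<noteq> m' S0" using S0(1) by (auto simp: D_def)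
  ultimately show False using eq[OF \<open>S0 \<in> B\<close>] by linarith
qed

text \<open>All solutions have the same letter multiplicities, so a single multinomial coefficient
  bounds their number. Reading the multiplicities off one solution \<open>c0\<close> avoids solving
  the linear system, and the bound is uniform in \<open>\<sigma>\<close>.\<close>

lemma card_fillings_le:
  fixes \<sigma> :: "'v set \<Rightarrow> nat" and U :: "nat set"
  assumes B: "finite B" "card B = Suc d" "\<And>A. A \<in> B \<Longrightarrow> finite A" and U: "finite U"
  shows "card {c \<in> U \<rightarrow>\<^sub>E B. \<forall>S\<in>B. card {t \<in> U. S \<subseteq> c t} = \<sigma> S}
           \<le> exp 1 * sqrt (2 * Suc d) ^ Suc d * Suc d ^ card U / sqrt (card U + 1) ^ d"
proof (cases "{c \<in> U \<rightarrow>\<^sub>E B. \<forall>S\<in>B. card {t \<in> U. S \<subseteq> c t} = \<sigma> S} = {}")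
  case True
  show ?thesis unfolding True by simp
next
  case False
  let ?L = "{c \<in> U \<rightarrow>\<^sub>E B. \<forall>S\<in>B. card {t \<in> U. S \<subseteq> c t} = \<sigma> S}"
  obtain c0 where c0: "c0 \<in> ?L" using False by blast
  define m where "m = (\<lambda>A. card {t \<in> U. c0 t = A})"
  define Q where "Q = {c \<in> U \<rightarrow>\<^sub>E B. \<forall>A\<in>B. card {t \<in> U. c t = A} = m A}"
  have m: "sum m B = card U"
  proof -
    have "card U = card (\<Union>A\<in>B. {t \<in> U. c0 t = A})"
      using c0 by (intro arg_cong[where f = card]) auto
    also have "\<dots> = sum m B"
      unfolding m_def using B U by (intro card_UN_disjoint) auto
    finally show ?thesis by simp
  qed
  have "?L \<subseteq> Q"
  proof
    fix c assume c: "c \<in> ?L"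
    have "card {t \<in> U. c t = A} = m A" if "A \<in> B" for A
      unfolding m_def
    proof (rule superset_sums_inj[OF B(1) B(3) _ that])
      fix S assume S: "S \<in> B"
      have "(\<Sum>A | A \<in> B \<and> S \<subseteq> A. card {t \<in> U. c t = A}) = card {t \<in> U. S \<subseteq> c t}"
        using c by (intro card_superset_eq_sum[symmetric] U B) auto
      also have "\<dots> = card {t \<in> U. S \<subseteq> c0 t}" using c c0 S by auto
      also have "\<dots> = (\<Sum>A | A \<in> B \<and> S \<subseteq> A. card {t \<in> U. c0 t = A})"
        using c0 by (intro card_superset_eq_sum U B) auto
      finally show "(\<Sum>A | A \<in> B \<and> S \<subseteq> A. card {t \<in> U. c t = A}) = \<dots>" .
    qed
    then show "c \<in> Q" using c by (auto simp: Q_def)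
  qed
  moreover have "finite Q"
    using U B by (intro finite_subset[OF _ finite_PiE[of U "\<lambda>_. B"]]) (auto simp: Q_def)
  ultimately have "card ?L \<le> card Q" by (intro card_mono)
  then have "real (card ?L) * (\<Prod>A\<in>B. fact (m A)) \<le> real (card Q) * (\<Prod>A\<in>B. fact (m A))"
    by (intro mult_right_mono) (auto intro!: prod_nonneg)
  also have "\<dots> = fact (card U)"
  proof -
    have "card Q * (\<Prod>A\<in>B. fact (m A)) = fact (card U)"
      using card_functions_of_type[OF B(1) U m] unfolding Q_def .
    then have "real (card Q * (\<Prod>A\<in>B. fact (m A))) = real (fact (card U))" by (rule arg_cong)
    then show ?thesis by simp
  qed
  also have "\<dots> \<le> exp 1 * sqrt (2 * Suc d) ^ Suc d * Suc d ^ card U / sqrt (card U + 1) ^ d * (\<Prod>A\<in>B. fact (m A))"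
    using m by (intro multinomial_le B) simp
  finally show ?thesis
    by (subst (asm) mult_le_cancel_right_pos) (auto intro!: prod_pos)
qed

definition cols :: "'v set \<Rightarrow> 'v set set \<Rightarrow> ('v set \<Rightarrow> nat) \<Rightarrow> nat \<Rightarrow> (nat \<Rightarrow> 'v set) set" where
  "cols V \<S> \<tau> n = {c \<in> {..<n} \<rightarrow>\<^sub>E Pow V. \<forall>S\<in>\<S>. card {t \<in> {..<n}. S \<subseteq> c t} = \<tau> S}"

lemma finite_cols: "finite V \<Longrightarrow> finite (cols V \<S> \<tau> n)"
  by (rule finite_subset[of _ "{..<n} \<rightarrow>\<^sub>E Pow V"]) (auto simp: cols_def intro!: finite_PiE)

text \<open>Fix the positions \<open>U\<close> of the letters in \<open>\<S> \<union> {{}}\<close> and all other letters. By triangularity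
  with respect to inclusion, the constraints then determine how often each letter occurs in \<open>U\<close>.\<close>
lemma card_cols_le:
  assumes V: "finite V" and \<S>: "\<S> \<subseteq> Pow V" "{} \<notin> \<S>" "card \<S> = d" and n: "n \<ge> 1"
  shows "card (cols V \<S> \<tau> n) \<le> exp 1 * sqrt (2 * Suc d) ^ Suc d * 2 ^ (d\<^sup>2) * (2 ^ card V) ^ d
           * (2 ^ card V) ^ n / sqrt n ^ d"
proof -
  \<comment> \<open>Every column contains \<open>{}\<close>, so its superset count is the length
    \<open>n\<close>. Thus the length becomes one more constraint of the same shape, and the
    \<open>d + 1\<close> letters of \<open>B\<close> face \<open>d + 1\<close> equations.\<close>
  define B where "B = insert {} \<S>"
  define F where "F = Pow V - B"
  define \<sigma> where "\<sigma> = (\<lambda>S. if S = {} then n else \<tau> S)"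
  \<comment> \<open>Truncated subtraction is harmless: for the two pieces of a sequence in
    \<open>cols\<close> the difference is exact, and for all other \<open>c'\<close> the bound of
    \<open>card_fillings_le\<close> holds whatever the right-hand sides are.\<close>
  define L where "L = (\<lambda>U c'. {c \<in> U \<rightarrow>\<^sub>E B. \<forall>S\<in>B. card {t \<in> U. S \<subseteq> c t}
      = \<sigma> S - card {t \<in> {..<n} - U. S \<subseteq> c' t}})"
  define Z where "Z = (SIGMA U:Pow {..<n}. SIGMA c':({..<n} - U) \<rightarrow>\<^sub>E F. L U c')"
  define \<Phi> where "\<Phi> = (\<lambda>c :: nat \<Rightarrow> 'a set. let U = {t \<in> {..<n}. c t \<in> B} in (U, restrict c ({..<n} - U), restrict c U))"
  define K where "K = exp 1 * sqrt (2 * Suc d) ^ Suc d"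
  have finS: "finite \<S>" using V \<S> by (meson finite_Pow_iff finite_subset)
  have B: "finite B" "card B = Suc d" "\<And>A. A \<in> B \<Longrightarrow> finite A" "B \<subseteq> Pow V"
    using finS \<S> V by (auto simp: B_def intro: finite_subset)
  have F: "finite F" "card F + Suc d = 2 ^ card V"
    using B V card_mono[of "Pow V" B] by (auto simp: F_def card_Diff_subset card_Pow)
  have finZ: "finite (({..<n} - U) \<rightarrow>\<^sub>E F)" "U \<in> Pow {..<n} \<Longrightarrow> finite (L U c')" for U c'
  proof -
    assume "U \<in> Pow {..<n}"
    then have "finite (U \<rightarrow>\<^sub>E B)" using B(1) by (intro finite_PiE) (auto intro: finite_subset)
    then show "finite (L U c')" by (rule finite_subset[rotated]) (auto simp: L_def)
  qed (use F in \<open>auto intro!: finite_PiE\<close>)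
  have "inj_on \<Phi> (cols V \<S> \<tau> n)"
  proof (rule inj_onI)
    fix c c' assume c: "c \<in> cols V \<S> \<tau> n" "c' \<in> cols V \<S> \<tau> n" and eq: "\<Phi> c = \<Phi> c'"
    define W where "W = (\<lambda>c. {t \<in> {..<n}. c t \<in> B})"
    from eq have W: "W c = W c'" and r': "restrict c ({..<n} - W c) = restrict c' ({..<n} - W c')"
        "restrict c (W c) = restrict c' (W c')"
      unfolding \<Phi>_def Let_def prod.inject W_def by blast+
    have r: "restrict c ({..<n} - W c) = restrict c' ({..<n} - W c)" "restrict c (W c) = restrict c' (W c)"
      using r' by (simp_all only: W)
    show "c = c'"
    proof (rule PiE_ext)
      show "c \<in> {..<n} \<rightarrow>\<^sub>E Pow V" "c' \<in> {..<n} \<rightarrow>\<^sub>E Pow V" using c by (auto simp: cols_def)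
      fix t assume t: "t \<in> {..<n}"
      show "c t = c' t"
      proof (cases "c t \<in> B")
        case True
        then show ?thesis using t fun_cong[OF r(2), of t] by (simp add: W_def)
      next
        case False
        then show ?thesis using t fun_cong[OF r(1), of t] by (simp add: W_def)
      qed
    qed
  qed
  moreover have "\<Phi> ` cols V \<S> \<tau> n \<subseteq> Z"
  proof (rule image_subsetI)
    fix c assume c: "c \<in> cols V \<S> \<tau> n"
    define U where "U = {t \<in> {..<n}. c t \<in> B}"
    have UF: "finite U" "U \<subseteq> {..<n}" by (auto simp: U_def)
    have "restrict c U \<in> L U (restrict c ({..<n} - U))"
      unfolding L_def
    proof (intro CollectI conjI ballI)
      show "restrict c U \<in> U \<rightarrow>\<^sub>E B" by (auto simp: U_def)
      fix S assume S: "S \<in> B"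
      have "{t \<in> {..<n}. S \<subseteq> c t} = {t \<in> U. S \<subseteq> c t} \<union> {t \<in> {..<n} - U. S \<subseteq> c t}"
        using UF by auto
      then have "card {t \<in> {..<n}. S \<subseteq> c t} = card {t \<in> U. S \<subseteq> c t} + card {t \<in> {..<n} - U. S \<subseteq> c t}"
        using UF by (simp only:) (intro card_Un_disjoint, auto)
      moreover have "card {t \<in> {..<n}. S \<subseteq> c t} = \<sigma> S"
        using S c by (auto simp: \<sigma>_def B_def cols_def)
      moreover have "{t \<in> U. S \<subseteq> restrict c U t} = {t \<in> U. S \<subseteq> c t}"
        "{t \<in> {..<n} - U. S \<subseteq> restrict c ({..<n} - U) t} = {t \<in> {..<n} - U. S \<subseteq> c t}" by auto
      ultimately show "card {t \<in> U. S \<subseteq> restrict c U t}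
          = \<sigma> S - card {t \<in> {..<n} - U. S \<subseteq> restrict c ({..<n} - U) t}" by simp
    qed
    moreover have "restrict c ({..<n} - U) \<in> ({..<n} - U) \<rightarrow>\<^sub>E F"
      using c by (auto simp: cols_def F_def U_def)
    ultimately show "\<Phi> c \<in> Z" by (simp add: \<Phi>_def Z_def Let_def flip: U_def) (auto simp: U_def)
  qed
  moreover have "finite Z"
    unfolding Z_def using finZ by (intro finite_SigmaI) auto
  ultimately have "card (cols V \<S> \<tau> n) \<le> card Z"
    by (rule card_inj_on_le)
  also have "card Z = (\<Sum>U\<in>Pow {..<n}. \<Sum>c'\<in>({..<n} - U) \<rightarrow>\<^sub>E F. card (L U c'))"
    unfolding Z_def using finZ by (subst card_SigmaI) (auto intro!: sum.cong card_SigmaI)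
  finally have "real (card (cols V \<S> \<tau> n)) \<le> (\<Sum>U\<in>Pow {..<n}. \<Sum>c'\<in>({..<n} - U) \<rightarrow>\<^sub>E F. real (card (L U c')))"
    by (simp flip: of_nat_sum)
  also have "\<dots> \<le> (\<Sum>U\<in>Pow {..<n}. \<Sum>c'\<in>({..<n} - U) \<rightarrow>\<^sub>E F. K * Suc d ^ card U / sqrt (card U + 1) ^ d)"
  proof (intro sum_mono)
    fix U c' assume "U \<in> Pow {..<n}"
    then show "card (L U c') \<le> K * Suc d ^ card U / sqrt (card U + 1) ^ d"
      unfolding L_def K_def by (intro card_fillings_le B) (auto intro: finite_subset)
  qed
  also have "\<dots> = (\<Sum>U\<in>Pow {..<n}. K * (real (card F) ^ (n - card U) * real (Suc d) ^ card U / sqrt (real (card U) + 1) ^ d))"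
    by (intro sum.cong) (auto simp: card_PiE card_Diff_subset finite_subset add.commute)
  also have "\<dots> = K * (\<Sum>U\<in>Pow {..<n}. real (card F) ^ (n - card U) * real (Suc d) ^ card U / sqrt (real (card U) + 1) ^ d)"
    by (rule sum_distrib_left[symmetric])
  \<comment> \<open>The weights \<open>card F\<close> off \<open>U\<close> and \<open>Suc d\<close>
    on \<open>U\<close> add up to the full alphabet size \<open>2 ^ card V\<close>. The subset sum
    shows that small \<open>U\<close>, where the denominator is weak, do not matter.\<close>
  also have "\<dots> \<le> K * (2 ^ (d\<^sup>2) * (card F + real (Suc d)) ^ d * (card F + real (Suc d)) ^ n / sqrt n ^ d)"
    using n by (intro mult_left_mono subset_sum_inverse_sqrt_power_le) (auto simp: K_def)
  also have "card F + real (Suc d) = 2 ^ card V"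
    using F(2) by (metis of_nat_add of_nat_numeral of_nat_power)
  finally show ?thesis by (simp add: K_def)
qed

lemma card_supersets:
  assumes "finite V" "S \<subseteq> V"
  shows "card {A \<in> Pow V. S \<subseteq> A} = 2 ^ (card V - card S)"
proof -
  have "bij_betw (\<lambda>A. A - S) {A \<in> Pow V. S \<subseteq> A} (Pow (V - S))"
    by (rule bij_betw_byWitness[where f' = "\<lambda>A. A \<union> S"]) (use assms in auto)
  then have "card {A \<in> Pow V. S \<subseteq> A} = card (Pow (V - S))" by (rule bij_betw_same_card)
  then show ?thesis using assms by (simp add: card_Pow card_Diff_subset finite_subset)
qed

text \<open>Equations are repaired from large sets to small ones by changing only the value at
  \<open>x\<close> itself. Since \<open>x\<close> contains no other set treated before, their
  equations stay intact. Each repair may multiply the deviation from \<open>\<mu>\<close> by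
  \<open>2 ^ card V\<close>. The values are integers because nonnegativity is known only later, from
  the final deviation bound.\<close>

lemma superset_sums_solvable:
  fixes g :: "'v set \<Rightarrow> int" and \<tau> :: "'v set \<Rightarrow> int" and \<mu> r :: real
  assumes V: "finite V" and B: "finite B" "B \<subseteq> Pow V"
    and \<tau>: "\<And>S. S \<in> B \<Longrightarrow> real_of_int (\<tau> S) = (\<Sum>A | A \<in> Pow V \<and> S \<subseteq> A. \<mu>)"
    and g: "\<And>A. A \<in> Pow V \<Longrightarrow> \<bar>g A - \<mu>\<bar> \<le> r"
  shows "\<exists>m :: 'v set \<Rightarrow> int. (\<forall>A\<in>Pow V - B. m A = g A) \<and>
     (\<forall>S\<in>B. (\<Sum>A | A \<in> Pow V \<and> S \<subseteq> A. m A) = \<tau> S) \<and>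
     (\<forall>A\<in>Pow V. \<bar>m A - \<mu>\<bar> \<le> (2 ^ card V) ^ card B * r)"
  using B \<tau>
proof (induction B rule: finite_ranking_induct[where f = "\<lambda>S. card V - card S"])
  case empty
  then show ?case using g by auto
next
  case (insert x B)
  obtain m where m: "\<forall>A\<in>Pow V - B. m A = g A"
     "\<forall>S\<in>B. (\<Sum>A | A \<in> Pow V \<and> S \<subseteq> A. m A) = \<tau> S"
     "\<And>A. A \<in> Pow V \<Longrightarrow> \<bar>m A - \<mu>\<bar> \<le> (2 ^ card V) ^ card B * r"
    using insert.IH insert.prems by auto
  show ?case
  proof (cases "x \<in> B")
    case True
    then show ?thesis using m by (auto simp: insert_absorb)
  next
    case False
    define X where "X = {A \<in> Pow V. x \<subseteq> A} - {x}"
    define m' where "m' = m(x := \<tau> x - sum m X)"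
    have finX: "finite X" using V by (simp add: X_def)
    have xV: "x \<in> Pow V" using insert.prems by simp
    have split: "(\<Sum>A | A \<in> Pow V \<and> x \<subseteq> A. f A) = f x + sum f X" for f :: "'v set \<Rightarrow> 'c :: comm_monoid_add"
      unfolding X_def using V xV by (intro sum.remove) auto
    have r: "r \<ge> 0" using g[of "{}"] by auto
    have 1: "(\<Sum>A | A \<in> Pow V \<and> S \<subseteq> A. m' A) = \<tau> S" if "S \<in> B" for S
    proof -
      have "\<not> S \<subseteq> x"
      proof
        assume "S \<subseteq> x"
        moreover have "S \<noteq> x" using that False by auto
        ultimately have "card S < card x" using xV V by (intro psubset_card_mono) (auto intro: finite_subset)
        moreover have "card V - card S \<le> card V - card x" using insert.hyps that by auto
        moreover have "card x \<le> card V" using xV V by (auto intro: card_mono)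
        ultimately show False by simp
      qed
      then have "(\<Sum>A | A \<in> Pow V \<and> S \<subseteq> A. m' A) = (\<Sum>A | A \<in> Pow V \<and> S \<subseteq> A. m A)"
        by (intro sum.cong) (auto simp: m'_def)
      then show ?thesis using m that by simp
    qed
    have 2: "(\<Sum>A | A \<in> Pow V \<and> x \<subseteq> A. m' A) = \<tau> x"
    proof -
      have "sum m' X = sum m X" by (intro sum.cong) (auto simp: m'_def X_def)
      then show ?thesis unfolding split by (simp add: m'_def)
    qed
    have 3: "\<bar>m' A - \<mu>\<bar> \<le> (2 ^ card V) ^ card (insert x B) * r" if A: "A \<in> Pow V" for A
    proof (cases "A = x")
      case True
      \<comment> \<open>The constant function \<open>\<mu>\<close> satisfies the equation at
        \<open>x\<close>, so the deviations over all supersets of \<open>x\<close> sum to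
        zero.\<close>
      have "real_of_int (m' x) - \<mu> = - (\<Sum>A\<in>X. (m A - \<mu>))"
        using insert.prems(2)[of x] unfolding split by (simp add: m'_def sum_subtractf)
      then have "\<bar>m' x - \<mu>\<bar> = \<bar>\<Sum>A\<in>X. (m A - \<mu>)\<bar>" by simp
      also have "\<dots> \<le> (\<Sum>A\<in>X. \<bar>m A - \<mu>\<bar>)" by (rule sum_abs)
      also have "\<dots> \<le> (\<Sum>A\<in>X. (2 ^ card V) ^ card B * r)"
        using m(3) by (intro sum_mono) (auto simp: X_def)
      also have "\<dots> \<le> (\<Sum>A\<in>Pow V. (2 ^ card V) ^ card B * r)"
        using r V by (intro sum_mono2) (auto simp: X_def)
      also have "\<dots> = (2 ^ card V) ^ card (insert x B) * r"
        using False insert.hyps V by (simp add: card_Pow)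
      finally show ?thesis using True by simp
    next
      case neq: False
      have "\<bar>m' A - \<mu>\<bar> \<le> (2 ^ card V) ^ card B * r" using m(3)[OF A] neq by (simp add: m'_def)
      also have "\<dots> \<le> (2 ^ card V) ^ card (insert x B) * r"
        using False insert.hyps r by (intro mult_right_mono power_increasing) auto
      finally show ?thesis .
    qed
    show ?thesis
    proof (intro exI[of _ m'] conjI ballI)
      show "m' A = g A" if "A \<in> Pow V - insert x B" for A using m that by (auto simp: m'_def)
    qed (use 1 2 3 in auto)
  qed
qed

text \<open>By the condition on \<open>\<tau>\<close>, the constant multiplicity
  \<open>n / q\<close> with \<open>q = 2 ^ card V\<close> solves all equations. Near it, letters
  outside \<open>B\<close> may have any multiplicities in a window of length about
  \<open>sqrt n\<close>, and the other \<open>d + 1\<close> are solved for. At least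
  \<open>sqrt n ^ (q - d - 1)\<close> types arise, each realised by at least order
  \<open>q ^ n / sqrt n ^ (q - 1)\<close> sequences.\<close>

lemma card_cols_ge:
  fixes V :: "'v set"
  assumes V: "finite V" and \<S>: "\<S> \<subseteq> Pow V" "{} \<notin> \<S>" "card \<S> = d"
  shows "\<exists>c>0. \<exists>n0. \<forall>n\<ge>n0. \<forall>\<tau>. (\<forall>S\<in>\<S>. \<tau> S * 2 ^ card S = n) \<longrightarrow>
           c * (2 ^ card V) ^ n / sqrt n ^ d \<le> card (cols V \<S> \<tau> n)"
proof -
  define B where "B = insert {} \<S>"
  define q where "q = (2 :: nat) ^ card V"
  \<comment> \<open>Free multiplicities deviate from \<open>\<mu>\<close> by at most
    \<open>2 * sqrt n\<close>, window and rounding together; the power is the amplification in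
    \<open>superset_sums_solvable\<close> for \<open>Suc d\<close> equations.\<close>
  define K :: real where "K = 2 * (2 ^ card V) ^ Suc d"
  define c where "c = exp (- real q - (real q)\<^sup>2 * K\<^sup>2)"
  have finS: "finite \<S>" using V \<S> by (meson finite_Pow_iff finite_subset)
  have B: "finite B" "card B = Suc d" "B \<subseteq> Pow V"
    using finS \<S> V by (auto simp: B_def intro: finite_subset)
  have F: "finite (Pow V - B)" "card (Pow V - B) + Suc d = q"
    using B V card_mono[of "Pow V" B] by (auto simp: card_Diff_subset card_Pow q_def)
  have q: "q \<ge> 1" "real q = 2 ^ card V" by (auto simp: q_def)
  \<comment> \<open>From here on \<open>K * sqrt n \<le> n / q\<close>, so the solved multiplicities
    cannot become negative.\<close>
  obtain n0 :: nat where n0: "real n0 \<ge> (q * K)\<^sup>2" using real_arch_simple by blast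
  show ?thesis
  proof (intro exI[of _ c] conjI exI[of _ "max 1 n0"] allI impI)
    show "c > 0" by (simp add: c_def)
    fix n \<tau> assume n: "max 1 n0 \<le> n" and \<tau>: "\<forall>S\<in>\<S>. \<tau> S * 2 ^ card S = n"
    define \<mu> where "\<mu> = real n / q"
    define \<sigma> where "\<sigma> = (\<lambda>S. if S = {} then n else \<tau> S)"
    define s where "s = \<lfloor>sqrt n\<rfloor>"
    define G where "G = (Pow V - B) \<rightarrow>\<^sub>E {\<lfloor>\<mu>\<rfloor>..\<lfloor>\<mu>\<rfloor> + s}"
    define good where "good = (\<lambda>g m. (\<forall>A\<in>Pow V - B. m A = g A) \<and>
     (\<forall>S\<in>B. (\<Sum>A | A \<in> Pow V \<and> S \<subseteq> A. m A) = int (\<sigma> S)) \<and>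
     (\<forall>A\<in>Pow V. \<bar>real_of_int (m A) - \<mu>\<bar> \<le> K * sqrt n))"
    have s0: "s \<ge> 0" by (simp add: s_def)
    have sq1: "sqrt n \<ge> 1" using n by simp
    have qK: "q * K \<le> sqrt n"
    proof (rule real_le_rsqrt)
      have "real n0 \<le> real n" using n by simp
      with n0 show "(q * K)\<^sup>2 \<le> n" by (rule order_trans)
    qed
    have "\<exists>m. good g m" if g: "g \<in> G" for g
    proof -
      \<comment> \<open>Starting values are needed on all of \<open>Pow V\<close>; those on
        \<open>B\<close> get overwritten, so any value near \<open>\<mu>\<close> will do.\<close>
      define g' where "g' = (\<lambda>A. if A \<in> Pow V - B then g A else \<lfloor>\<mu>\<rfloor>)"
      have "real_of_int (int (\<sigma> S)) = (\<Sum>A | A \<in> Pow V \<and> S \<subseteq> A. \<mu>)" if S: "S \<in> B" for S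
      proof -
        have SV: "S \<subseteq> V" "card S \<le> card V" using S B V by (auto intro: card_mono)
        have "\<sigma> S * 2 ^ card S = n" using \<tau> S by (auto simp: \<sigma>_def B_def)
        then have sig: "real (\<sigma> S) * 2 ^ card S = n" by (simp flip: of_nat_eq_iff[where 'a = real])
        have sum_eq: "(\<Sum>A | A \<in> Pow V \<and> S \<subseteq> A. \<mu>) = 2 ^ (card V - card S) * \<mu>"
          by (subst sum_constant, subst card_supersets[OF V SV(1)]) simp
        moreover have "real q = 2 ^ (card V - card S) * 2 ^ card S"
          using SV by (simp add: q flip: power_add)
        ultimately have "real_of_int (int (\<sigma> S)) = 2 ^ (card V - card S) * \<mu>"
          using sig by (simp add: field_simps \<mu>_def)
        then show ?thesis unfolding sum_eq .
      qed
      moreover have "\<bar>g' A - \<mu>\<bar> \<le> 2 * sqrt n" if "A \<in> Pow V" for A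
      proof -
        have "\<lfloor>\<mu>\<rfloor> \<le> g' A \<and> g' A \<le> \<lfloor>\<mu>\<rfloor> + s" using g s0 that by (force simp: g'_def G_def)
        then have "\<mu> - 1 \<le> g' A \<and> g' A \<le> \<mu> + sqrt n" unfolding s_def by linarith
        then show ?thesis using sq1 by linarith
      qed
      ultimately have "\<exists>m. (\<forall>A\<in>Pow V - B. m A = g' A) \<and>
         (\<forall>S\<in>B. (\<Sum>A | A \<in> Pow V \<and> S \<subseteq> A. m A) = int (\<sigma> S)) \<and>
         (\<forall>A\<in>Pow V. \<bar>m A - \<mu>\<bar> \<le> (2 ^ card V) ^ card B * (2 * sqrt n))"
        using V B by (intro superset_sums_solvable) auto
      then show ?thesis by (simp add: good_def g'_def K_def B mult_ac)
    qed
    then obtain M where M: "\<And>g. g \<in> G \<Longrightarrow> good g (M g)" by metis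
    define Q where "Q = (\<lambda>g. {c \<in> {..<n} \<rightarrow>\<^sub>E Pow V. \<forall>A\<in>Pow V. card {t \<in> {..<n}. c t = A} = nat (M g A)})"
    have nonneg: "M g A \<ge> 0" if "g \<in> G" "A \<in> Pow V" for g A
    proof -
      have "K * sqrt n \<le> \<mu>"
        using qK q mult_right_mono[OF qK, of "sqrt n"] by (simp add: \<mu>_def field_simps)
      moreover have "\<bar>real_of_int (M g A) - \<mu>\<bar> \<le> K * sqrt n" using M that by (auto simp: good_def)
      ultimately show ?thesis by linarith
    qed
    have sums: "(\<Sum>A | A \<in> Pow V \<and> S \<subseteq> A. nat (M g A)) = \<sigma> S" if "g \<in> G" "S \<in> B" for g S
    proof -
      have "int (\<Sum>A | A \<in> Pow V \<and> S \<subseteq> A. nat (M g A)) = (\<Sum>A | A \<in> Pow V \<and> S \<subseteq> A. M g A)"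
        unfolding of_nat_sum using nonneg[OF that(1)] by (intro sum.cong) auto
      also have "\<dots> = int (\<sigma> S)" using M[OF that(1)] that(2) by (auto simp: good_def)
      finally show ?thesis by (simp only: of_nat_eq_iff)
    qed
    have total: "(\<Sum>A\<in>Pow V. nat (M g A)) = n" if "g \<in> G" for g
      using sums[OF that, of "{}"] by (simp add: B_def \<sigma>_def Pow_def)
    have finQ: "finite (Q g)" for g
      using V by (intro finite_subset[OF _ finite_PiE[of "{..<n}" "\<lambda>_. Pow V"]]) (auto simp: Q_def)
    have cardQ: "c * real q ^ n * sqrt n / sqrt n ^ q \<le> card (Q g)" if g: "g \<in> G" for g
    proof -
      have "c * real q ^ n * sqrt n / sqrt n ^ q * (\<Prod>A\<in>Pow V. fact (nat (M g A))) \<le> fact n"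
        unfolding c_def
      proof (rule multinomial_ge[where m = "\<lambda>A. nat (M g A)" and B = "Pow V"])
        show "\<bar>real (nat (M g A)) - real n / q\<bar> \<le> K * sqrt n" if "A \<in> Pow V" for A
          using M[OF g] nonneg[OF g that] that by (auto simp: good_def \<mu>_def)
      qed (use V q n total[OF g] in \<open>auto simp: card_Pow q_def\<close>)
      also have "fact n = real (card (Q g)) * (\<Prod>A\<in>Pow V. fact (nat (M g A)))"
      proof -
        have "card (Q g) * (\<Prod>A\<in>Pow V. fact (nat (M g A))) = fact n"
          using card_functions_of_type[of "Pow V" "{..<n}" "\<lambda>A. nat (M g A)"] total[OF g] V
          unfolding Q_def by simp
        then have "real (card (Q g) * (\<Prod>A\<in>Pow V. fact (nat (M g A)))) = real (fact n)" by (rule arg_cong)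
        then show ?thesis by simp
      qed
      finally show ?thesis
        by (subst (asm) mult_le_cancel_right_pos) (auto intro!: prod_pos)
    qed
    \<comment> \<open>The type of a sequence determines \<open>M g\<close>, and \<open>g\<close> is
      its part outside \<open>B\<close>.\<close>
    have "disjoint_family_on Q G"
    proof (unfold disjoint_family_on_def, intro ballI impI, rule ccontr)
      fix g g' assume g: "g \<in> G" "g' \<in> G" "g \<noteq> g'" and "Q g \<inter> Q g' \<noteq> {}"
      then have "nat (M g A) = nat (M g' A)" if "A \<in> Pow V" for A
        using that by (auto simp: Q_def)
      then have "M g A = M g' A" if "A \<in> Pow V" for A
        using nonneg g that by (metis nat_0_le)
      then have "g A = g' A" if "A \<in> Pow V - B" for A
        using that M[OF g(1)] M[OF g(2)] by (auto simp: good_def)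
      then have "g = g'" using g by (intro PiE_ext[of _ "Pow V - B"]) (auto simp: G_def)
      then show False using g by simp
    qed
    then have dis: "card (\<Union> (Q ` G)) = (\<Sum>g\<in>G. card (Q g))"
      using F finQ by (intro card_UN_disjoint) (auto simp: G_def disjoint_family_on_def intro!: finite_PiE)
    have "\<Union> (Q ` G) \<subseteq> cols V \<S> \<tau> n"
    proof
      fix c assume "c \<in> \<Union> (Q ` G)"
      then obtain g where g: "g \<in> G" and c: "c \<in> Q g" by auto
      have "card {t \<in> {..<n}. S \<subseteq> c t} = \<tau> S" if S: "S \<in> \<S>" for S
      proof -
        have "card {t \<in> {..<n}. S \<subseteq> c t} = (\<Sum>A | A \<in> Pow V \<and> S \<subseteq> A. card {t \<in> {..<n}. c t = A})"
          using c V by (intro card_superset_eq_sum) (auto simp: Q_def)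
        also have "\<dots> = (\<Sum>A | A \<in> Pow V \<and> S \<subseteq> A. nat (M g A))"
          using c by (intro sum.cong) (auto simp: Q_def)
        also have "\<dots> = \<tau> S" using sums[OF g, of S] S \<S> by (auto simp: B_def \<sigma>_def)
        finally show ?thesis .
      qed
      then show "c \<in> cols V \<S> \<tau> n" using c by (auto simp: cols_def Q_def)
    qed
    then have "card (\<Union> (Q ` G)) \<le> card (cols V \<S> \<tau> n)"
      by (intro card_mono finite_cols V)
    moreover have "c * (2 ^ card V) ^ n / sqrt n ^ d \<le> card (\<Union> (Q ` G))"
    proof -
      have "card G = nat (s + 1) ^ card (Pow V - B)"
        using F by (simp add: G_def card_PiE)
      then have "real (card G) = (real_of_int s + 1) ^ card (Pow V - B)"
        using s0 by simp
      moreover have "sqrt n ^ card (Pow V - B) \<le> (real_of_int s + 1) ^ card (Pow V - B)"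
        by (intro power_mono) (auto simp: s_def)
      ultimately have cG: "sqrt n ^ card (Pow V - B) \<le> card G" by simp
      have "c * (2 ^ card V) ^ n / sqrt n ^ d = sqrt n ^ card (Pow V - B) * (c * real q ^ n * sqrt n / sqrt n ^ q)"
      proof -
        have "sqrt n ^ q = sqrt n ^ card (Pow V - B) * (sqrt n * sqrt n ^ d)"
          unfolding F(2)[symmetric] by (simp add: power_add)
        then show ?thesis using sq1 by (simp add: q(2))
      qed
      also have "\<dots> \<le> card G * (c * real q ^ n * sqrt n / sqrt n ^ q)"
        by (intro mult_right_mono cG) (auto simp: c_def)
      also have "\<dots> = (\<Sum>g\<in>G. (c * real q ^ n * sqrt n / sqrt n ^ q))" by simp
      also have "\<dots> \<le> (\<Sum>g\<in>G. real (card (Q g)))" by (intro sum_mono cardQ)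
      also have "\<dots> = card (\<Union> (Q ` G))" by (simp add: dis)
      finally show ?thesis .
    qed
    ultimately show "c * (2 ^ card V) ^ n / sqrt n ^ d \<le> card (cols V \<S> \<tau> n)" by linarith
  qed
qed

section \<open>Homomorphisms into the distance graph\<close>

lemma sum_list_01:
  fixes x :: "nat list"
  assumes "set x \<subseteq> {0,1}"
  shows "sum_list x = card {t \<in> {..<length x}. x ! t = 1}"
proof -
  have "sum_list x = (\<Sum>t<length x. x ! t)"
    by (simp add: sum_list_sum_nth atLeast0LessThan)
  also have "\<dots> = (\<Sum>t<length x. if x ! t = 1 then 1 else 0)"
    using assms nth_mem by (intro sum.cong) fastforce+
  also have "\<dots> = card {t \<in> {..<length x}. x ! t = 1}"
    by (simp add: sum.If_cases Int_def)
  finally show ?thesis .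
qed

lemma dg_V_nth:
  assumes "x \<in> dg_V n" "t < n"
  shows "x ! t = 0 \<or> x ! t = 1"
proof -
  have "x ! t \<in> set x" "set x \<subseteq> {0, 1}" using assms by (auto simp: dg_V_def)
  then show ?thesis by blast
qed

lemma inner_01:
  assumes "x \<in> dg_V n" "y \<in> dg_V n"
  shows "inner x y = card {t \<in> {..<n}. x ! t = 1 \<and> y ! t = 1}"
proof -
  have *: "x ! t = 0 \<or> x ! t = 1" "y ! t = 0 \<or> y ! t = 1" if "t < n" for t
    using assms that dg_V_nth by blast+
  have "set (map2 (*) x y) \<subseteq> {0, 1}"
    using assms * by (fastforce simp: set_zip dg_V_def)
  then have "inner x y = card {t \<in> {..<n}. map2 (*) x y ! t = 1}"
    using assms by (simp add: inner_def sum_list_01 dg_V_def)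
  also have "{t \<in> {..<n}. map2 (*) x y ! t = 1} = {t \<in> {..<n}. x ! t = 1 \<and> y ! t = 1}"
    using assms by (auto simp: dg_V_def)
  finally show ?thesis .
qed

lemma dg_E_pair_iff:
  assumes "x \<in> dg_V n" "y \<in> dg_V n"
  shows "{x, y} \<in> dg_E n \<longleftrightarrow> card {t \<in> {..<n}. x ! t = 1 \<and> y ! t = 1} = n div 4"
proof -
  have "inner y x = inner x y"
    using assms by (simp add: inner_01 conj_commute)
  then have "{x, y} \<in> dg_E n \<longleftrightarrow> inner x y = n div 4"
    using assms unfolding dg_E_def mem_Collect_eq doubleton_eq_iff by metis
  then show ?thesis by (simp only: inner_01[OF assms])
qed

lemma finite_dg_V: "finite (dg_V n)"
  by (rule finite_subset[OF _ finite_lists_length_eq[of "{0,1}" n]]) (auto simp: dg_V_def)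

lemma finite_dg_E: "finite (dg_E n)"
  by (rule finite_subset[of _ "Pow (dg_V n)"]) (auto simp: dg_E_def finite_dg_V)

text \<open>Injectivity is left out so that the maps correspond exactly to column sequences;
  non-injective maps are subtracted later.\<close>

definition homs :: "'v set \<Rightarrow> 'v set set \<Rightarrow> nat \<Rightarrow> ('v \<Rightarrow> nat list) set" where
  "homs V E n = {f \<in> V \<rightarrow>\<^sub>E dg_V n. \<forall>e\<in>E. f ` e \<in> dg_E n}"

lemma finite_homs: "finite V \<Longrightarrow> finite (homs V E n)"
  by (rule finite_subset[of _ "V \<rightarrow>\<^sub>E dg_V n"]) (auto simp: homs_def finite_dg_V intro!: finite_PiE)

text \<open>The coordinates \<open>t\<close> of the vectors \<open>f v\<close> are turned into the columns \<open>{v. f v ! t = 1}\<close>.\<close>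
lemma card_homs_eq_cols:
  assumes G: "simple_graph V E"
  shows "card (homs V E n) = card (cols V ((\<lambda>v. {v}) ` V \<union> E) (\<lambda>S. n div 2 ^ card S) n)"
proof -
  define \<phi> where "\<phi> = (\<lambda>f :: 'a \<Rightarrow> nat list. \<lambda>t\<in>{..<n}. {v \<in> V. f v ! t = 1})"
  define \<psi> where "\<psi> = (\<lambda>c :: nat \<Rightarrow> 'a set. \<lambda>v\<in>V. map (\<lambda>t. if v \<in> c t then 1 else 0 :: nat) [0..<n])"
  have supp: "{t \<in> {..<n}. \<psi> c v ! t = 1} = {t \<in> {..<n}. v \<in> c t}" if "v \<in> V" for c v
    using that by (auto simp: \<psi>_def split: if_splits)
  have edge: "f ` e \<in> dg_E n \<longleftrightarrow> card {t \<in> {..<n}. e \<subseteq> \<phi> f t} = n div 4"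
    if f: "f \<in> V \<rightarrow> dg_V n" and e: "e \<in> E" for f e
  proof -
    from e G have "card e = 2" "e \<subseteq> V" by (auto simp: simple_graph_def)
    then obtain u v where uv: "e = {u, v}" "u \<in> V" "v \<in> V"
      by (auto simp: card_2_iff)
    have "{t \<in> {..<n}. e \<subseteq> \<phi> f t} = {t \<in> {..<n}. f u ! t = 1 \<and> f v ! t = 1}"
      using uv by (auto simp: \<phi>_def)
    moreover have "f u \<in> dg_V n" "f v \<in> dg_V n" using f uv by auto
    ultimately show ?thesis using uv by (simp add: dg_E_pair_iff)
  qed
  have "bij_betw \<phi> (homs V E n) (cols V ((\<lambda>v. {v}) ` V \<union> E) (\<lambda>S. n div 2 ^ card S) n)"
  proof (rule bij_betw_byWitness[where f' = \<psi>])
    show "\<forall>f\<in>homs V E n. \<psi> (\<phi> f) = f"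
    proof
      fix f assume f: "f \<in> homs V E n"
      show "\<psi> (\<phi> f) = f"
      proof (rule PiE_ext)
        show "f \<in> V \<rightarrow>\<^sub>E UNIV" "\<psi> (\<phi> f) \<in> V \<rightarrow>\<^sub>E UNIV" using f by (auto simp: homs_def \<psi>_def PiE_def)
        fix v assume v: "v \<in> V"
        then have fv: "f v \<in> dg_V n" using f by (auto simp: homs_def)
        then have "f v ! t = 0 \<or> f v ! t = 1" if "t < n" for t
          using that by (rule dg_V_nth)
        with v fv show "\<psi> (\<phi> f) v = f v"
          by (intro nth_equalityI) (auto simp: \<psi>_def \<phi>_def dg_V_def)
      qed
    qed
    show "\<forall>c\<in>cols V ((\<lambda>v. {v}) ` V \<union> E) (\<lambda>S. n div 2 ^ card S) n. \<phi> (\<psi> c) = c"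
    proof
      fix c assume c: "c \<in> cols V ((\<lambda>v. {v}) ` V \<union> E) (\<lambda>S. n div 2 ^ card S) n"
      show "\<phi> (\<psi> c) = c"
      proof (rule PiE_ext)
        show "c \<in> {..<n} \<rightarrow>\<^sub>E UNIV" "\<phi> (\<psi> c) \<in> {..<n} \<rightarrow>\<^sub>E UNIV" using c by (auto simp: cols_def \<phi>_def PiE_def)
        fix t assume t: "t \<in> {..<n}"
        then have "c t \<subseteq> V" using c by (auto simp: cols_def)
        then show "\<phi> (\<psi> c) t = c t" using t by (auto simp: \<psi>_def \<phi>_def split: if_splits)
      qed
    qed
    show "\<phi> ` homs V E n \<subseteq> cols V ((\<lambda>v. {v}) ` V \<union> E) (\<lambda>S. n div 2 ^ card S) n"
    proof (rule image_subsetI)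
      fix f assume f: "f \<in> homs V E n"
      show "\<phi> f \<in> cols V ((\<lambda>v. {v}) ` V \<union> E) (\<lambda>S. n div 2 ^ card S) n"
        unfolding cols_def
      proof (intro CollectI conjI ballI)
        show "\<phi> f \<in> {..<n} \<rightarrow>\<^sub>E Pow V" by (auto simp: \<phi>_def)
        fix S assume "S \<in> (\<lambda>v. {v}) ` V \<union> E"
        then show "card {t \<in> {..<n}. S \<subseteq> \<phi> f t} = n div 2 ^ card S"
        proof
          assume "S \<in> E"
          then show ?thesis using edge[of f S] f G by (auto simp: homs_def simple_graph_def)
        next
          assume "S \<in> (\<lambda>v. {v}) ` V"
          then obtain v where v: "S = {v}" "v \<in> V" by auto
          then have fv: "f v \<in> dg_V n" using f by (auto simp: homs_def)
          have "{t \<in> {..<n}. S \<subseteq> \<phi> f t} = {t \<in> {..<length (f v)}. f v ! t = 1}"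
            using v fv by (auto simp: \<phi>_def dg_V_def)
          then show ?thesis using v fv sum_list_01[of "f v"] by (auto simp: dg_V_def)
        qed
      qed
    qed
    show "\<psi> ` cols V ((\<lambda>v. {v}) ` V \<union> E) (\<lambda>S. n div 2 ^ card S) n \<subseteq> homs V E n"
    proof (rule image_subsetI)
      fix c assume c: "c \<in> cols V ((\<lambda>v. {v}) ` V \<union> E) (\<lambda>S. n div 2 ^ card S) n"
      have V: "\<psi> c v \<in> dg_V n" if v: "v \<in> V" for v
      proof -
        have 1: "length (\<psi> c v) = n" "set (\<psi> c v) \<subseteq> {0, 1}" using v by (auto simp: \<psi>_def)
        have "card {t \<in> {..<n}. {v} \<subseteq> c t} = n div 2 ^ card {v}"
          using c v unfolding cols_def by blast
        then show ?thesis
          using sum_list_01[OF 1(2)] 1 supp[OF v, of c] by (simp add: dg_V_def)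
      qed
      show "\<psi> c \<in> homs V E n"
        unfolding homs_def
      proof (intro CollectI conjI ballI)
        show "\<psi> c \<in> V \<rightarrow>\<^sub>E dg_V n" using V by (auto simp: \<psi>_def PiE_def)
        fix e assume e: "e \<in> E"
        have "\<phi> (\<psi> c) t = c t" if "t \<in> {..<n}" for t
        proof -
          have "c t \<subseteq> V" using c that by (auto simp: cols_def)
          then show ?thesis using that by (auto simp: \<psi>_def \<phi>_def split: if_splits)
        qed
        then have "{t \<in> {..<n}. e \<subseteq> \<phi> (\<psi> c) t} = {t \<in> {..<n}. e \<subseteq> c t}" by auto
        moreover have "card {t \<in> {..<n}. e \<subseteq> c t} = n div 2 ^ card e"
          using c e unfolding cols_def by blast
        moreover have "card e = 2" using G e by (simp add: simple_graph_def)
        ultimately show "\<psi> c ` e \<in> dg_E n" using edge[of "\<psi> c" e] V e by simp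
      qed
    qed
  qed
  then show ?thesis by (rule bij_betw_same_card)
qed

lemma singletons_Un_edges:
  assumes "simple_graph V E"
  shows "(\<lambda>v. {v}) ` V \<union> E \<subseteq> Pow V" "{} \<notin> (\<lambda>v. {v}) ` V \<union> E"
    "card ((\<lambda>v. {v}) ` V \<union> E) = card V + card E" "finite V" "finite E"
proof -
  show fin: "finite V" "finite E"
    using assms by (auto simp: simple_graph_def intro: finite_subset[of _ "Pow V"])
  show "(\<lambda>v. {v}) ` V \<union> E \<subseteq> Pow V" "{} \<notin> (\<lambda>v. {v}) ` V \<union> E"
    using assms by (auto simp: simple_graph_def)
  have "(\<lambda>v. {v}) ` V \<inter> E = {}" using assms by (auto simp: simple_graph_def)
  then show "card ((\<lambda>v. {v}) ` V \<union> E) = card V + card E"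
    using fin by (subst card_Un_disjoint) (auto simp: card_image)
qed

text \<open>The constant depends on \<open>K\<close> alone, since this will be applied to unions of
  copies, whose vertices are vectors of length \<open>n\<close>. This is possible because singletons
  and edges are distinct subsets of \<open>V\<close>, so there are at most \<open>2 ^ K\<close>
  constraints.\<close>

lemma card_homs_le:
  "\<exists>C>0. \<forall>(V :: 'v set) E n. simple_graph V E \<longrightarrow> card V \<le> K \<longrightarrow> n \<ge> 1 \<longrightarrow>
     card (homs V E n) \<le> C * (2 ^ n) ^ card V / sqrt n ^ (card V + card E)"
proof -
  define D where "D = (2 :: nat) ^ K"
  define C where "C = exp 1 * sqrt (2 * Suc D) ^ Suc D * 2 ^ (D\<^sup>2) * (2 ^ K) ^ D"
  show ?thesis
  proof (intro exI[of _ C] conjI allI impI)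
    show "C > 0" by (simp add: C_def)
    fix V :: "'v set" and E and n :: nat
    assume G: "simple_graph V E" and K: "card V \<le> K" and n: "1 \<le> n"
    define d where "d = card V + card E"
    note S = singletons_Un_edges[OF G]
    have "d \<le> card (Pow V)" unfolding d_def S(3)[symmetric] using S by (intro card_mono) auto
    also have "\<dots> \<le> D" using S(4) K by (simp add: card_Pow D_def)
    finally have dD: "d \<le> D" .
    have "card (homs V E n) \<le> exp 1 * sqrt (2 * Suc d) ^ Suc d * 2 ^ (d\<^sup>2) * (2 ^ card V) ^ d
           * (2 ^ card V) ^ n / sqrt n ^ d"
      unfolding card_homs_eq_cols[OF G] using n S by (intro card_cols_le) (auto simp: d_def)
    also have "\<dots> \<le> exp 1 * sqrt (2 * Suc D) ^ Suc D * 2 ^ (D\<^sup>2) * (2 ^ K) ^ D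
           * (2 ^ card V) ^ n / sqrt n ^ d"
    proof (intro divide_right_mono mult_mono mult_nonneg_nonneg)
      have "sqrt (2 * Suc d) ^ Suc d \<le> sqrt (2 * Suc D) ^ Suc d"
        using dD by (intro power_mono) auto
      also have "\<dots> \<le> sqrt (2 * Suc D) ^ Suc D"
        using dD by (intro power_increasing) auto
      finally show "sqrt (2 * Suc d) ^ Suc d \<le> sqrt (2 * Suc D) ^ Suc D" .
      have "(2 ^ card V) ^ d \<le> (2 ^ K :: real) ^ d"
        using K by (intro power_mono) auto
      also have "\<dots> \<le> (2 ^ K :: real) ^ D"
        using dD by (intro power_increasing) auto
      finally show "(2 ^ card V) ^ d \<le> (2 ^ K :: real) ^ D" .
    qed (use dD in auto)
    also have "\<dots> = C * (2 ^ n) ^ card V / sqrt n ^ (card V + card E)"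
      by (simp add: C_def d_def mult.commute flip: power_mult)
    finally show "card (homs V E n) \<le> C * (2 ^ n) ^ card V / sqrt n ^ (card V + card E)" .
  qed
qed

text \<open>Divisibility by 4 turns the quotients \<open>n div 2\<close> and \<open>n div 4\<close>
  into the exact equations that \<open>card_cols_ge\<close> requires.\<close>

lemma card_homs_ge:
  assumes G: "simple_graph V E"
  shows "\<exists>c>0. \<exists>n0. \<forall>n\<ge>n0. 4 dvd n \<longrightarrow>
     c * (2 ^ n) ^ card V / sqrt n ^ (card V + card E) \<le> card (homs V E n)"
proof -
  note S = singletons_Un_edges[OF G]
  obtain c n0 where c: "c > 0" and cols: "\<And>n \<tau>. n \<ge> n0 \<Longrightarrow> (\<forall>S\<in>(\<lambda>v. {v}) ` V \<union> E. \<tau> S * 2 ^ card S = n) \<Longrightarrow>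
           c * (2 ^ card V) ^ n / sqrt n ^ (card V + card E) \<le> card (cols V ((\<lambda>v. {v}) ` V \<union> E) \<tau> n)"
    using card_cols_ge[OF S(4,1,2,3)] by metis
  show ?thesis
  proof (intro exI[of _ c] conjI exI[of _ n0] allI impI)
    fix n :: nat assume n: "n \<ge> n0" and n4: "4 dvd n"
    have "n div 2 ^ card S * 2 ^ card S = n" if "S \<in> (\<lambda>v. {v}) ` V \<union> E" for S
    proof -
      have "card S = 1 \<or> card S = 2" using that G by (auto simp: simple_graph_def)
      moreover have "2 dvd n" using n4 by (rule dvd_trans[rotated]) simp
      ultimately show ?thesis using n4 by auto
    qed
    then show "c * (2 ^ n) ^ card V / sqrt n ^ (card V + card E) \<le> card (homs V E n)"
      unfolding card_homs_eq_cols[OF G]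
      using cols[OF n, of "\<lambda>S. n div 2 ^ card S"] by (simp add: mult.commute flip: power_mult)
  qed (rule c)
qed

text \<open>With this, the order \<open>2 ^ n / sqrt n\<close> of \<open>N\<close> is an instance of
  the general homomorphism bounds.\<close>

lemma dg_N_eq_homs: "dg_N n = card (homs {()} {} n)"
  by (simp add: dg_N_def homs_def card_PiE)

lemma dg_N_bounds:
  "\<exists>c>0. \<exists>C>0. \<exists>n0. \<forall>n\<ge>n0. 4 dvd n \<longrightarrow> c * (2 ^ n / sqrt n) \<le> dg_N n \<and> dg_N n \<le> C * (2 ^ n / sqrt n)"
proof -
  have G: "simple_graph {()} {}" by (simp add: simple_graph_def)
  obtain C where C: "C > 0" "\<And>(V :: unit set) E n. simple_graph V E \<Longrightarrow> card V \<le> 1 \<Longrightarrow> n \<ge> 1 \<Longrightarrow>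
     card (homs V E n) \<le> C * (2 ^ n) ^ card V / sqrt n ^ (card V + card E)"
    using card_homs_le[where 'v = unit and K = 1] by auto
  obtain c n0 where c: "c > 0" "\<And>n. n \<ge> n0 \<Longrightarrow> 4 dvd n \<Longrightarrow>
     c * (2 ^ n) ^ card {()} / sqrt n ^ (card {()} + card ({} :: unit set set)) \<le> card (homs {()} {} n)"
    using card_homs_ge[OF G] by auto
  have "c * (2 ^ n / sqrt n) \<le> dg_N n \<and> dg_N n \<le> C * (2 ^ n / sqrt n)" if "n \<ge> max 1 n0" "4 dvd n" for n
    using C(2)[OF G, of n] c(2)[of n] that unfolding dg_N_eq_homs by simp
  then show ?thesis using c(1) C(1) by blast
qed

lemma dg_N_le: "dg_N n \<le> 2 ^ n"
proof -
  have "card (dg_V n) \<le> card {x. set x \<subseteq> {0,1::nat} \<and> length x = n}"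
    by (intro card_mono finite_lists_length_eq) (auto simp: dg_V_def)
  then have "card (dg_V n) \<le> 2 ^ n" by (simp add: card_lists_length_eq numeral_2_eq_2)
  then show ?thesis unfolding dg_N_def by (metis of_nat_le_iff of_nat_numeral of_nat_power)
qed

lemma card_homs_le_dg_N:
  "\<exists>C>0. \<exists>n0. \<forall>n\<ge>n0. 4 dvd n \<longrightarrow> (\<forall>(V :: 'v set) E. simple_graph V E \<longrightarrow> card V \<le> K \<longrightarrow>
     card (homs V E n) \<le> C * dg_N n ^ card V / sqrt n ^ card E)"
proof -
  obtain C where C: "C > 0" "\<And>(V :: 'v set) E n. simple_graph V E \<Longrightarrow> card V \<le> K \<Longrightarrow> n \<ge> 1 \<Longrightarrow>
     card (homs V E n) \<le> C * (2 ^ n) ^ card V / sqrt n ^ (card V + card E)"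
    using card_homs_le[where 'v = 'v and K = K] by auto
  obtain c n0 where c: "c > 0" "\<And>n. n \<ge> n0 \<Longrightarrow> 4 dvd n \<Longrightarrow> c * (2 ^ n / sqrt n) \<le> dg_N n"
    using dg_N_bounds by metis
  \<comment> \<open>The maximum with 1 allows bounding \<open>M ^ card V\<close> by
    \<open>M ^ K\<close>, which keeps the constant independent of the graph.\<close>
  define M where "M = max 1 (1 / c)"
  have M: "M \<ge> 1" "1 / c \<le> M" by (auto simp: M_def)
  show ?thesis
  proof (intro exI[of _ "C * M ^ K"] conjI exI[of _ "max 1 n0"] allI impI)
    show "C * M ^ K > 0" using C M by auto
    fix n V E
    assume n: "max 1 n0 \<le> n" "4 dvd n" and G: "simple_graph (V :: 'v set) E" "card V \<le> K"
    have N: "dg_N n \<ge> 0" by (simp add: dg_N_def)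
    have "2 ^ n / sqrt n \<le> 1 / c * dg_N n"
      using c(1) c(2)[of n] n by (simp add: pos_le_divide_eq mult.commute)
    also have "\<dots> \<le> M * dg_N n" using M N by (intro mult_right_mono)
    finally have "(2 ^ n / sqrt n) ^ card V \<le> (M * dg_N n) ^ card V" by (intro power_mono) auto
    also have "\<dots> \<le> M ^ K * dg_N n ^ card V"
      unfolding power_mult_distrib using M N G by (intro mult_right_mono power_increasing) auto
    finally have *: "(2 ^ n / sqrt n) ^ card V \<le> M ^ K * dg_N n ^ card V" .
    have "card (homs V E n) \<le> C * (2 ^ n / sqrt n) ^ card V / sqrt n ^ card E"
      using C(2)[OF G, of n] n by (simp add: power_add power_divide)
    also have "\<dots> \<le> C * (M ^ K * dg_N n ^ card V) / sqrt n ^ card E"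
      using C * by (intro divide_right_mono mult_left_mono) auto
    finally show "card (homs V E n) \<le> C * M ^ K * dg_N n ^ card V / sqrt n ^ card E" by (simp add: mult_ac)
  qed
qed

section \<open>Injective homomorphisms and the size of ln N\<close>

definition inj_homs :: "'v set \<Rightarrow> 'v set set \<Rightarrow> nat \<Rightarrow> ('v \<Rightarrow> nat list) set" where
  "inj_homs V E n = {f \<in> homs V E n. inj_on f V}"

text \<open>A map with \<open>f u = f v\<close> is determined by its values off \<open>v\<close>;
  the square bounds the number of pairs \<open>(u, v)\<close>.\<close>

lemma card_not_inj_le:
  assumes V: "finite V" "V \<noteq> {}"
  shows "card {f \<in> V \<rightarrow>\<^sub>E dg_V n. \<not> inj_on f V} \<le> (card V)\<^sup>2 * card (dg_V n) ^ (card V - 1)"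
proof -
  define Q where "Q = (\<lambda>(u, v). {f \<in> V \<rightarrow>\<^sub>E dg_V n. f u = f v})"
  define P where "P = {(u, v) \<in> V \<times> V. u \<noteq> v}"
  have fin: "finite P" "finite (Q uv)" for uv
  proof -
    show "finite P" using V by (intro finite_subset[of P "V \<times> V"]) (auto simp: P_def)
    show "finite (Q uv)" using V finite_dg_V
      by (intro finite_subset[OF _ finite_PiE[of V "\<lambda>_. dg_V n"]]) (auto simp: Q_def split: prod.splits)
  qed
  have "card P \<le> card (V \<times> V)" using V by (intro card_mono) (auto simp: P_def)
  then have P: "card P \<le> (card V)\<^sup>2" by (simp add: card_cartesian_product power2_eq_square)
  have Q: "card (Q uv) \<le> card (dg_V n) ^ (card V - 1)" if uvP: "uv \<in> P" for uv
  proof -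
    obtain u v where uv: "uv = (u, v)" "u \<in> V" "v \<in> V" "u \<noteq> v" using uvP unfolding P_def by blast
    have "card (Q uv) \<le> card ((V - {v}) \<rightarrow>\<^sub>E dg_V n)"
    proof (rule card_inj_on_le)
      show "inj_on (\<lambda>f. restrict f (V - {v})) (Q uv)"
      proof (rule inj_onI)
        fix f g assume fg: "f \<in> Q uv" "g \<in> Q uv" "restrict f (V - {v}) = restrict g (V - {v})"
        have eq: "f w = g w" if "w \<in> V - {v}" for w using fun_cong[OF fg(3), of w] that by simp
        show "f = g"
        proof (rule PiE_ext)
          show "f \<in> V \<rightarrow>\<^sub>E dg_V n" "g \<in> V \<rightarrow>\<^sub>E dg_V n" using fg by (auto simp: Q_def uv)
          show "f w = g w" if "w \<in> V" for w
            using eq[of w] eq[of u] that fg uv by (cases "w = v") (auto simp: Q_def)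
        qed
      qed
      show "(\<lambda>f. restrict f (V - {v})) ` Q uv \<subseteq> (V - {v}) \<rightarrow>\<^sub>E dg_V n"
      proof (rule image_subsetI)
        fix f assume "f \<in> Q uv"
        then have "\<forall>w\<in>V. f w \<in> dg_V n" by (auto simp: Q_def uv)
        then show "restrict f (V - {v}) \<in> (V - {v}) \<rightarrow>\<^sub>E dg_V n" by (simp add: restrict_PiE_iff)
      qed
    qed (use V finite_dg_V in \<open>auto intro!: finite_PiE\<close>)
    also have "\<dots> = card (dg_V n) ^ (card V - 1)" using V uv by (simp add: card_PiE)
    finally show ?thesis .
  qed
  have "card {f \<in> V \<rightarrow>\<^sub>E dg_V n. \<not> inj_on f V} \<le> card (\<Union> (Q ` P))"
    using fin by (intro card_mono) (auto simp: Q_def P_def inj_on_def)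
  also have "\<dots> \<le> (\<Sum>uv\<in>P. card (Q uv))" using fin by (intro card_UN_le)
  also have "\<dots> \<le> (\<Sum>uv\<in>P. card (dg_V n) ^ (card V - 1))" using Q by (intro sum_mono)
  also have "\<dots> \<le> (card V)\<^sup>2 * card (dg_V n) ^ (card V - 1)" using P by simp
  finally show ?thesis .
qed

text \<open>Dropping injectivity violations loses at most order \<open>N ^ (k - 1)\<close>. As
  \<open>N\<close> is exponential in \<open>n\<close> while the edges cost only a power of
  \<open>n\<close>, this is eventually at most half of the lower bound for all
  homomorphisms.\<close>

lemma card_inj_homs_ge:
  assumes G: "simple_graph V E" and V: "V \<noteq> {}"
  shows "\<exists>c>0. \<exists>n0. \<forall>n\<ge>n0. 4 dvd n \<longrightarrow> c * dg_N n ^ card V / sqrt n ^ card E \<le> card (inj_homs V E n)"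
proof -
  define k where "k = card V"
  have fV: "finite V" "k \<ge> 1" using G V by (auto simp: simple_graph_def k_def card_gt_0_iff Suc_le_eq)
  obtain c1 n1 where c1: "c1 > 0" "\<And>n. n \<ge> n1 \<Longrightarrow> 4 dvd n \<Longrightarrow>
     c1 * (2 ^ n) ^ k / sqrt n ^ (k + card E) \<le> card (homs V E n)"
    using card_homs_ge[OF G] unfolding k_def by metis
  obtain a C n2 where a: "a > 0" "C > 0" "\<And>n. n \<ge> n2 \<Longrightarrow> 4 dvd n \<Longrightarrow> a * (2 ^ n / sqrt n) \<le> dg_N n"
    "\<And>n. n \<ge> n2 \<Longrightarrow> 4 dvd n \<Longrightarrow> dg_N n \<le> C * (2 ^ n / sqrt n)"
    using dg_N_bounds by metis
  \<comment> \<open>The bound with \<open>c1\<close> is in powers of \<open>2 ^ n / sqrt n\<close>;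
    the upper bound on \<open>N\<close> with \<open>C\<close> converts these to powers of
    \<open>N\<close>.\<close>
  define c where "c = c1 / C ^ k"
  have c: "c > 0" using c1 a by (simp add: c_def)
  have "eventually (\<lambda>n :: nat. 2 * real k ^ 2 * sqrt n ^ card E / c \<le> a * (2 ^ n / sqrt n)) at_top"
    using a(1) c by real_asymp
  then obtain n3 where n3: "\<And>n. n \<ge> n3 \<Longrightarrow> 2 * real k ^ 2 * sqrt n ^ card E / c \<le> a * (2 ^ n / sqrt n)"
    unfolding eventually_at_top_linorder by auto
  show ?thesis
  proof (intro exI[of _ "c / 2"] conjI exI[of _ "Max {1, n1, n2, n3}"] allI impI)
    show "c / 2 > 0" using c by simp
    fix n assume n: "n \<ge> Max {1, n1, n2, n3}" "4 dvd n"
    define N where "N = dg_N n"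
    have N0: "N \<ge> 0" by (simp add: N_def dg_N_def)
    have sq: "sqrt n \<ge> 1" using n by simp
    have "c * N ^ k \<le> c * (C * (2 ^ n / sqrt n)) ^ k"
      using a(4)[of n] n c N0 by (intro mult_left_mono power_mono) (auto simp: N_def)
    also have "\<dots> = c1 * (2 ^ n) ^ k / sqrt n ^ k"
      using a by (simp add: c_def power_mult_distrib power_divide)
    finally have "c * N ^ k / sqrt n ^ card E \<le> (c1 * (2 ^ n) ^ k / sqrt n ^ k) / sqrt n ^ card E"
      by (intro divide_right_mono) auto
    also have "\<dots> \<le> card (homs V E n)" using c1(2)[of n] n by (simp add: power_add)
    finally have 1: "c * N ^ k / sqrt n ^ card E \<le> card (homs V E n)" .
    have "2 * real k ^ 2 * sqrt n ^ card E / c \<le> N"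
      using n3[of n] a(3)[of n] n by (simp add: N_def)
    then have "2 * real k ^ 2 * sqrt n ^ card E \<le> N * c" using c by (simp add: pos_divide_le_eq)
    then have "(2 * real k ^ 2 * sqrt n ^ card E) * N ^ (k - 1) \<le> (N * c) * N ^ (k - 1)"
      using N0 by (intro mult_right_mono) auto
    also have "\<dots> = c * N ^ k" using fV by (cases k) auto
    finally have 2: "real k ^ 2 * N ^ (k - 1) \<le> c / 2 * N ^ k / sqrt n ^ card E"
      using sq by (simp add: field_simps)
    have "homs V E n \<subseteq> inj_homs V E n \<union> {f \<in> V \<rightarrow>\<^sub>E dg_V n. \<not> inj_on f V}"
      by (auto simp: inj_homs_def homs_def)
    moreover have "finite (inj_homs V E n)" using finite_homs[OF fV(1)] by (auto simp: inj_homs_def)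
    moreover have "finite {f \<in> V \<rightarrow>\<^sub>E dg_V n. \<not> inj_on f V}"
      using fV finite_dg_V by (auto intro!: finite_subset[OF _ finite_PiE[of V "\<lambda>_. dg_V n"]])
    ultimately have "card (homs V E n) \<le> card (inj_homs V E n \<union> {f \<in> V \<rightarrow>\<^sub>E dg_V n. \<not> inj_on f V})"
      by (intro card_mono) auto
    also have "\<dots> \<le> card (inj_homs V E n) + card {f \<in> V \<rightarrow>\<^sub>E dg_V n. \<not> inj_on f V}"
      by (rule card_Un_le)
    also have "\<dots> \<le> card (inj_homs V E n) + k\<^sup>2 * card (dg_V n) ^ (k - 1)"
      using card_not_inj_le[OF fV(1) V] by (simp add: k_def)
    finally have "real (card (homs V E n)) \<le> real (card (inj_homs V E n) + k\<^sup>2 * card (dg_V n) ^ (k - 1))"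
      by (rule of_nat_mono)
    then have "real (card (homs V E n)) \<le> card (inj_homs V E n) + real k ^ 2 * N ^ (k - 1)"
      by (simp add: N_def dg_N_def)
    with 1 2 show "c / 2 * dg_N n ^ card V / sqrt n ^ card E \<le> card (inj_homs V E n)"
      by (simp add: N_def k_def)
  qed
qed

text \<open>Since \<open>exp (1 / 2) \<le> 2\<close>, \<open>N\<close> is at least of order
  \<open>exp (n / 2) / sqrt n\<close>; the slack down to \<open>exp (n / 4)\<close> absorbs the
  constant and the square root.\<close>

lemma ln_dg_N_bounds:
  "eventually (\<lambda>n. 4 dvd n \<longrightarrow> real n / 4 \<le> ln (dg_N n) \<and> ln (dg_N n) \<le> n \<and> dg_N n > 1) sequentially"
proof -
  obtain c n0 where c: "c > 0" "\<And>n. n \<ge> n0 \<Longrightarrow> 4 dvd n \<Longrightarrow> c * (2 ^ n / sqrt n) \<le> dg_N n"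
    using dg_N_bounds by metis
  have "eventually (\<lambda>n :: nat. exp (real n / 4) \<le> c * (exp (real n / 2) / sqrt n)) sequentially"
    using c(1) by real_asymp
  moreover have "eventually (\<lambda>n. n \<ge> max 1 n0) sequentially" by (rule eventually_ge_at_top)
  ultimately show ?thesis
  proof eventually_elim
    case (elim n)
    show ?case
    proof
      assume "4 dvd n"
      have "exp (1 / 2 :: real) ^ 2 \<le> 2 ^ 2"
        using e_less_272 by (simp flip: exp_of_nat_mult)
      then have "exp (1 / 2 :: real) \<le> 2" by (rule power2_le_imp_le) simp
      then have "exp (1 / 2 :: real) ^ n \<le> 2 ^ n" by (intro power_mono) auto
      then have "exp (real n / 2) \<le> 2 ^ n" by (simp flip: exp_of_nat_mult)
      then have "c * (exp (real n / 2) / sqrt n) \<le> c * (2 ^ n / sqrt n)"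
        using c(1) by (intro mult_left_mono divide_right_mono) auto
      then have N: "exp (real n / 4) \<le> dg_N n" using c(2)[of n] elim \<open>4 dvd n\<close> by simp
      moreover have "1 < exp (real n / 4)" using elim by simp
      ultimately have N1: "dg_N n > 1" by linarith
      have "ln (exp (real n / 4)) \<le> ln (dg_N n)"
        using N N1 by (subst ln_le_cancel_iff) auto
      moreover have "dg_N n \<le> exp (real n)"
      proof -
        have "(2 :: real) ^ n \<le> exp 1 ^ n" using exp_ge_add_one_self[of 1] by (intro power_mono) auto
        then show ?thesis using dg_N_le[of n] by (simp flip: exp_of_nat_mult)
      qed
      then have "ln (dg_N n) \<le> ln (exp (real n))"
        using N1 by (subst ln_le_cancel_iff) auto
      ultimately show "real n / 4 \<le> ln (dg_N n) \<and> ln (dg_N n) \<le> n \<and> dg_N n > 1" using N1 by simp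
    qed
  qed
qed

section \<open>Moments of the number of copies\<close>

lemma set_pmf_Gp: "set_pmf (Gp n p) \<subseteq> Pow (dg_E n)"
  by (auto simp: Gp_def)

lemma finite_set_pmf_Gp: "finite (set_pmf (Gp n p))"
  using set_pmf_Gp finite_dg_E by (meson finite_Pow_iff finite_subset)

lemma prob_Gp_superset:
  assumes "D \<subseteq> dg_E n" "0 \<le> p" "p \<le> 1"
  shows "measure_pmf.prob (Gp n p) {H. D \<subseteq> H} = p ^ card D"
proof -
  have "(\<lambda>\<omega>. {e \<in> dg_E n. \<omega> e}) -` {H. D \<subseteq> H} = Pi (dg_E n) (\<lambda>e. if e \<in> D then {True} else UNIV)"
    using assms by (auto simp: Pi_def split: if_splits)
  then have "measure_pmf.prob (Gp n p) {H. D \<subseteq> H}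
      = (\<Prod>e\<in>dg_E n. measure_pmf.prob (bernoulli_pmf p) (if e \<in> D then {True} else UNIV))"
    by (simp add: Gp_def measure_Pi_pmf_Pi finite_dg_E)
  also have "\<dots> = (\<Prod>e\<in>dg_E n. if e \<in> D then p else 1)"
    using assms by (intro prod.cong) (auto simp: measure_pmf_single)
  also have "\<dots> = p ^ card D"
    using assms finite_dg_E by (simp add: prod.If_cases Int_absorb1)
  finally show ?thesis .
qed

lemma expectation_Gp_superset:
  assumes "D \<subseteq> dg_E n" "0 \<le> p" "p \<le> 1"
  shows "measure_pmf.expectation (Gp n p) (\<lambda>H. of_bool (D \<subseteq> H) :: real) = p ^ card D"
proof -
  have "(\<lambda>H. of_bool (D \<subseteq> H) :: real) = indicator {H. D \<subseteq> H}" by (auto simp: indicator_def)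
  then show ?thesis using prob_Gp_superset[OF assms] by simp
qed

text \<open>To be instantiated with the copies in the complete graph as \<open>I\<close> and
  \<open>snd\<close> as \<open>D\<close>. Indexing is essential: copies that differ only in isolated
  vertices have the same edge set but count separately.\<close>

context
  fixes I :: "'i set" and D :: "'i \<Rightarrow> nat list set set" and X :: "nat list set set \<Rightarrow> real"
    and n e :: nat and p :: real
  assumes I: "finite I" and D: "\<And>i. i \<in> I \<Longrightarrow> D i \<subseteq> dg_E n" "\<And>i. i \<in> I \<Longrightarrow> card (D i) = e"
    and p: "0 \<le> p" "p \<le> 1"
    and X: "\<And>H. H \<subseteq> dg_E n \<Longrightarrow> X H = (\<Sum>i\<in>I. of_bool (D i \<subseteq> H))"
begin

lemma expectation_count:
  "measure_pmf.expectation (Gp n p) X = card I * p ^ e"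
proof -
  have "measure_pmf.expectation (Gp n p) X = measure_pmf.expectation (Gp n p) (\<lambda>H. \<Sum>i\<in>I. of_bool (D i \<subseteq> H))"
    using X set_pmf_Gp[of n p] by (intro integral_cong_AE) (auto simp: AE_measure_pmf_iff)
  also have "\<dots> = (\<Sum>i\<in>I. p ^ e)"
    using D p by (subst Bochner_Integration.integral_sum)
      (auto simp: integrable_measure_pmf_finite finite_set_pmf_Gp expectation_Gp_superset)
  finally show ?thesis by simp
qed

text \<open>Pairs with disjoint edge sets have covariance zero; for the others the subtracted
  product of expectations is dropped.\<close>

lemma variance_count_le:
  "measure_pmf.variance (Gp n p) X \<le> (\<Sum>(i, j)\<in>I \<times> I. of_bool (D i \<inter> D j \<noteq> {}) * p ^ card (D i \<union> D j))"
proof -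
  have "measure_pmf.expectation (Gp n p) (\<lambda>H. (X H)\<^sup>2)
      = measure_pmf.expectation (Gp n p) (\<lambda>H. \<Sum>(i, j)\<in>I \<times> I. of_bool (D i \<union> D j \<subseteq> H))"
    using X set_pmf_Gp[of n p]
    by (intro integral_cong_AE)
      (auto simp: AE_measure_pmf_iff power2_eq_square sum_product sum.cartesian_product simp flip: of_bool_conj)
  also have "\<dots> = (\<Sum>x\<in>I \<times> I. measure_pmf.expectation (Gp n p) (\<lambda>H. of_bool (D (fst x) \<union> D (snd x) \<subseteq> H)))"
    unfolding case_prod_beta
    by (intro Bochner_Integration.integral_sum integrable_measure_pmf_finite finite_set_pmf_Gp)
  also have "\<dots> = (\<Sum>(i, j)\<in>I \<times> I. p ^ card (D i \<union> D j))"
    unfolding case_prod_beta using D by (intro sum.cong expectation_Gp_superset p refl) fastforce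
  finally have E2: "measure_pmf.expectation (Gp n p) (\<lambda>H. (X H)\<^sup>2) = (\<Sum>(i, j)\<in>I \<times> I. p ^ card (D i \<union> D j))" .
  have "(measure_pmf.expectation (Gp n p) X)\<^sup>2 = (\<Sum>(i, j)\<in>I \<times> I. p ^ e * p ^ e)"
    unfolding expectation_count by (simp add: card_cartesian_product power2_eq_square)
  then have "measure_pmf.variance (Gp n p) X = (\<Sum>(i, j)\<in>I \<times> I. p ^ card (D i \<union> D j) - p ^ e * p ^ e)"
    by (subst measure_pmf.variance_eq)
      (simp_all add: integrable_measure_pmf_finite finite_set_pmf_Gp E2 sum_subtractf case_prod_beta)
  also have "\<dots> \<le> (\<Sum>(i, j)\<in>I \<times> I. of_bool (D i \<inter> D j \<noteq> {}) * p ^ card (D i \<union> D j))"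
  proof (rule sum_mono, clarify)
    fix i j assume ij: "i \<in> I" "j \<in> I"
    show "p ^ card (D i \<union> D j) - p ^ e * p ^ e \<le> of_bool (D i \<inter> D j \<noteq> {}) * p ^ card (D i \<union> D j)"
    proof (cases "D i \<inter> D j = {}")
      case True
      moreover have "finite (D i)" "finite (D j)"
        using finite_subset[OF D(1) finite_dg_E] ij by auto
      ultimately have "card (D i \<union> D j) = e + e"
        using ij D by (subst card_Un_disjoint) auto
      with True show ?thesis by (simp add: power_add)
    next
      case False
      then show ?thesis using p by simp
    qed
  qed
  finally show ?thesis .
qed

lemma prob_count_concentrated:
  assumes "\<epsilon> > 0" "measure_pmf.expectation (Gp n p) X > 0"
  shows "measure_pmf.prob (Gp n p) {H. \<bar>X H / measure_pmf.expectation (Gp n p) X - 1\<bar> < \<epsilon>}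
     \<ge> 1 - (\<Sum>(i, j)\<in>I \<times> I. of_bool (D i \<inter> D j \<noteq> {}) * p ^ card (D i \<union> D j))
           / (\<epsilon>\<^sup>2 * (measure_pmf.expectation (Gp n p) X)\<^sup>2)"
proof -
  define \<mu> where "\<mu> = measure_pmf.expectation (Gp n p) X"
  have \<mu>: "\<mu> > 0" using assms by (simp add: \<mu>_def)
  have "\<bar>X H / \<mu> - 1\<bar> < \<epsilon> \<longleftrightarrow> \<not> \<epsilon> * \<mu> \<le> \<bar>X H - \<mu>\<bar>" for H
  proof -
    have "\<bar>X H / \<mu> - 1\<bar> = \<bar>X H - \<mu>\<bar> / \<mu>"
    proof -
      have "X H / \<mu> - 1 = (X H - \<mu>) / \<mu>" using \<mu> by (simp add: diff_divide_distrib)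
      then show ?thesis using \<mu> by (simp add: abs_divide)
    qed
    then show ?thesis using \<mu> by (simp add: pos_divide_less_eq not_le)
  qed
  then have "measure_pmf.prob (Gp n p) {H. \<bar>X H / \<mu> - 1\<bar> < \<epsilon>}
     = measure_pmf.prob (Gp n p) (space (Gp n p) - {H \<in> space (Gp n p). \<epsilon> * \<mu> \<le> \<bar>X H - \<mu>\<bar>})"
    by (intro arg_cong[where f = "measure_pmf.prob (Gp n p)"]) auto
  also have "\<dots> = 1 - measure_pmf.prob (Gp n p) {H \<in> space (Gp n p). \<epsilon> * \<mu> \<le> \<bar>X H - \<mu>\<bar>}"
    by (intro measure_pmf.prob_compl) simp
  finally have eq: "measure_pmf.prob (Gp n p) {H. \<bar>X H / \<mu> - 1\<bar> < \<epsilon>} = \<dots>" .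
  have "measure_pmf.prob (Gp n p) {H \<in> space (Gp n p). \<epsilon> * \<mu> \<le> \<bar>X H - \<mu>\<bar>}
     \<le> measure_pmf.variance (Gp n p) X / (\<epsilon> * \<mu>)\<^sup>2"
    unfolding \<mu>_def using assms
    by (intro measure_pmf.Chebyshev_inequality) (auto simp: integrable_measure_pmf_finite finite_set_pmf_Gp)
  also have "\<dots> \<le> (\<Sum>(i, j)\<in>I \<times> I. of_bool (D i \<inter> D j \<noteq> {}) * p ^ card (D i \<union> D j)) / (\<epsilon> * \<mu>)\<^sup>2"
    by (intro divide_right_mono variance_count_le) auto
  finally show ?thesis using eq by (simp add: power_mult_distrib \<mu>_def)
qed

end

section \<open>Copies as images of injective homomorphisms\<close>

definition copy :: "'v set \<Rightarrow> 'v set set \<Rightarrow> ('v \<Rightarrow> nat list) \<Rightarrow> nat list set \<times> nat list set set" where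
  "copy V E f = (f ` V, (\<lambda>e. f ` e) ` E)"

text \<open>This makes the index set independent of the random \<open>H\<close>, so that
  \<open>X_F\<close> becomes a fixed sum of indicators.\<close>

lemma copies_subset_eq:
  assumes "H \<subseteq> dg_E n"
  shows "copies V E n H = {c \<in> copies V E n (dg_E n). snd c \<subseteq> H}"
proof (intro set_eqI iffI)
  fix c assume "c \<in> copies V E n H"
  then obtain f where f: "c = (f ` V, (\<lambda>e. f ` e) ` E)" "inj_on f V" "f ` V \<subseteq> dg_V n" "(\<lambda>e. f ` e) ` E \<subseteq> H"
    unfolding copies_def by blast
  from f(4) assms have "(\<lambda>e. f ` e) ` E \<subseteq> dg_E n" by (rule order_trans)
  then have "c \<in> copies V E n (dg_E n)" using f(1-3) unfolding copies_def by blast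
  then show "c \<in> {c \<in> copies V E n (dg_E n). snd c \<subseteq> H}" using f(1,4) by simp
next
  fix c assume "c \<in> {c \<in> copies V E n (dg_E n). snd c \<subseteq> H}"
  then obtain f where f: "c = (f ` V, (\<lambda>e. f ` e) ` E)" "inj_on f V" "f ` V \<subseteq> dg_V n" "snd c \<subseteq> H"
    unfolding copies_def by blast
  from f(4) have "(\<lambda>e. f ` e) ` E \<subseteq> H" unfolding f(1) snd_conv .
  then show "c \<in> copies V E n H" using f(1-3) unfolding copies_def by blast
qed

lemma copies_eq_image_inj_homs:
  assumes G: "simple_graph V E"
  shows "copies V E n (dg_E n) = copy V E ` inj_homs V E n"
proof
  show "copy V E ` inj_homs V E n \<subseteq> copies V E n (dg_E n)"
  proof (rule image_subsetI)
    fix f assume "f \<in> inj_homs V E n"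
    then have "inj_on f V" "f ` V \<subseteq> dg_V n" "(\<lambda>e. f ` e) ` E \<subseteq> dg_E n"
      by (auto simp: inj_homs_def homs_def)
    then show "copy V E f \<in> copies V E n (dg_E n)" unfolding copies_def copy_def by blast
  qed
  show "copies V E n (dg_E n) \<subseteq> copy V E ` inj_homs V E n"
  proof
    fix c assume "c \<in> copies V E n (dg_E n)"
    then obtain f where f: "c = (f ` V, (\<lambda>e. f ` e) ` E)" "inj_on f V" "f ` V \<subseteq> dg_V n"
      "(\<lambda>e. f ` e) ` E \<subseteq> dg_E n"
      unfolding copies_def by blast
    have e: "restrict f V ` e = f ` e" if "e \<in> E" for e
      using that G unfolding simple_graph_def by (intro image_cong) auto
    have "restrict f V \<in> inj_homs V E n"
      using f e by (auto simp: inj_homs_def homs_def inj_on_def)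
    moreover have "copy V E (restrict f V) = c"
      unfolding copy_def f(1) using e by (auto intro!: image_cong)
    ultimately show "c \<in> copy V E ` inj_homs V E n" by blast
  qed
qed

lemma inj_on_image_edges:
  assumes "simple_graph V E" "inj_on f V"
  shows "inj_on ((`) f) E"
  using assms inj_on_image_eq_iff[of f V] unfolding simple_graph_def inj_on_def by metis

text \<open>A copy fixes the image of \<open>V\<close>, which leaves at most
  \<open>card V ^ card V\<close> maps. This crude bound stands in for the number of automorphisms
  and costs only a constant.\<close>

lemma card_inj_homs_le_copies:
  assumes G: "simple_graph V E"
  shows "card (inj_homs V E n) \<le> card (copies V E n (dg_E n)) * card V ^ card V"
proof -
  have V: "finite V" using G by (simp add: simple_graph_def)
  have fin: "finite (inj_homs V E n)" using finite_homs[OF V] by (auto simp: inj_homs_def)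
  have "card (inj_homs V E n) = card (\<Union>c\<in>copy V E ` inj_homs V E n. {f \<in> inj_homs V E n. copy V E f = c})"
    by (intro arg_cong[where f = card]) auto
  also have "\<dots> \<le> (\<Sum>c\<in>copy V E ` inj_homs V E n. card {f \<in> inj_homs V E n. copy V E f = c})"
    using fin by (intro card_UN_le) auto
  also have "\<dots> \<le> (\<Sum>c\<in>copy V E ` inj_homs V E n. card V ^ card V)"
  proof (rule sum_mono)
    fix c assume "c \<in> copy V E ` inj_homs V E n"
    then obtain f where f: "f \<in> inj_homs V E n" "c = copy V E f" by auto
    have "{g \<in> inj_homs V E n. copy V E g = c} \<subseteq> V \<rightarrow>\<^sub>E f ` V"
      using f by (auto simp: inj_homs_def homs_def copy_def)
    then have "card {g \<in> inj_homs V E n. copy V E g = c} \<le> card (V \<rightarrow>\<^sub>E f ` V)"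
      using V by (intro card_mono finite_PiE) auto
    also have "\<dots> = card V ^ card V"
      using V f by (simp add: card_PiE inj_homs_def card_image)
    finally show "card {g \<in> inj_homs V E n. copy V E g = c} \<le> card V ^ card V" .
  qed
  finally show ?thesis using copies_eq_image_inj_homs[OF G] by simp
qed

text \<open>Records how two copies are glued together. Being a subset of
  \<open>V \<times> V\<close>, it takes a number of values that is bounded independently of
  \<open>n\<close>.\<close>

definition overlap :: "'v set \<Rightarrow> ('v \<Rightarrow> nat list) \<times> ('v \<Rightarrow> nat list) \<Rightarrow> ('v \<times> 'v) set" where
  "overlap V = (\<lambda>(f, g). {(u, v) \<in> V \<times> V. f u = g v})"

definition union_edges :: "'v set \<Rightarrow> 'v set set \<Rightarrow> ('v \<Rightarrow> nat list) \<times> ('v \<Rightarrow> nat list) \<Rightarrow> nat list set set" where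
  "union_edges V E = (\<lambda>(f, g). snd (copy V E f) \<union> snd (copy V E g))"

definition union_vertices :: "'v set \<Rightarrow> ('v \<Rightarrow> nat list) \<times> ('v \<Rightarrow> nat list) \<Rightarrow> nat list set" where
  "union_vertices V = (\<lambda>(f, g). f ` V \<union> g ` V)"

context
  fixes V :: "'v set" and E :: "'v set set" and n :: nat
  assumes G: "simple_graph V E"
begin

text \<open>The amalgam of two copies of the graph along a given overlap is realised by the union of a
  representative pair of copies, so no abstract amalgam has to be constructed.\<close>
lemma same_overlap_hom:
  assumes f: "f \<in> inj_homs V E n" "g \<in> inj_homs V E n"
    and f': "f' \<in> inj_homs V E n" "g' \<in> inj_homs V E n"
    and eq: "overlap V (f', g') = overlap V (f, g)"
  shows "\<exists>h\<in>homs (union_vertices V (f, g)) (union_edges V E (f, g)) n. inj_on h (union_vertices V (f, g)) \<and>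
     (\<forall>v\<in>V. h (f v) = f' v \<and> h (g v) = g' v)"
proof -
  define W where "W = union_vertices V (f, g)"
  \<comment> \<open>On the image of \<open>f\<close>, go back along \<open>f\<close> and on by
    \<open>f'\<close>; elsewhere use \<open>g\<close> and \<open>g'\<close>. Equal overlaps make the
    two recipes agree where both apply.\<close>
  define h where "h = (\<lambda>x\<in>W. if x \<in> f ` V then f' (inv_into V f x) else g' (inv_into V g x))"
  have inj: "inj_on f V" "inj_on g V" "inj_on f' V" "inj_on g' V"
    using f f' by (auto simp: inj_homs_def)
  have ov: "f u = g v \<longleftrightarrow> f' u = g' v" if "u \<in> V" "v \<in> V" for u v
    using eq that by (auto simp: overlap_def set_eq_iff)
  have hf: "h (f v) = f' v" if "v \<in> V" for v
    using that inj by (auto simp: h_def W_def union_vertices_def)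
  have hg: "h (g v) = g' v" if v: "v \<in> V" for v
  proof (cases "g v \<in> f ` V")
    case True
    then obtain u where u: "u \<in> V" "f u = g v" by auto
    then show ?thesis using hf[of u] ov[OF u(1) v] by simp
  next
    case False
    then show ?thesis using v inj by (auto simp: h_def W_def union_vertices_def)
  qed
  have EV: "e \<subseteq> V" if "e \<in> E" for e using G that by (auto simp: simple_graph_def)
  have edges: "h ` f ` e = f' ` e" "h ` g ` e = g' ` e" if "e \<in> E" for e
    using EV[OF that] hf hg by (force simp: image_image)+
  have "inj_on h W"
  proof (rule inj_onI)
    fix x y assume "x \<in> W" "y \<in> W" and h: "h x = h y"
    then consider (1) u v where "x = f u" "y = f v" "u \<in> V" "v \<in> V"
      | (2) u v where "x = f u" "y = g v" "u \<in> V" "v \<in> V"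
      | (3) u v where "x = g u" "y = f v" "u \<in> V" "v \<in> V"
      | (4) u v where "x = g u" "y = g v" "u \<in> V" "v \<in> V"
      unfolding W_def union_vertices_def by auto
    then show "x = y"
    proof cases
      case 1 then show ?thesis using h hf inj by (auto simp: inj_on_def)
    next
      case 2 then show ?thesis using h hf hg ov by auto
    next
      case 3 then show ?thesis using h hf[of v] hg[of u] ov[of v u] by auto
    next
      case 4 then show ?thesis using h hg inj by (auto simp: inj_on_def)
    qed
  qed
  moreover have "h \<in> homs W (union_edges V E (f, g)) n"
    unfolding homs_def
  proof (intro CollectI conjI ballI)
    have "h x \<in> dg_V n" if "x \<in> W" for x
    proof -
      from that obtain v where "v \<in> V" "x = f v \<or> x = g v" by (auto simp: W_def union_vertices_def)
      then have "h x = f' v \<or> h x = g' v" using hf hg by auto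
      then show ?thesis using f' \<open>v \<in> V\<close> by (auto simp: inj_homs_def homs_def)
    qed
    then show "h \<in> W \<rightarrow>\<^sub>E dg_V n" by (auto simp: h_def)
    fix e assume "e \<in> union_edges V E (f, g)"
    then obtain e' where "e' \<in> E" "e = f ` e' \<or> e = g ` e'" by (auto simp: union_edges_def copy_def)
    then show "h ` e \<in> dg_E n"
      using edges f' by (auto simp: inj_homs_def homs_def)
  qed
  ultimately show ?thesis unfolding W_def[symmetric] using hf hg by blast
qed

lemma simple_graph_union:
  assumes f: "f \<in> inj_homs V E n" "g \<in> inj_homs V E n"
  shows "simple_graph (union_vertices V (f, g)) (union_edges V E (f, g))"
proof -
  have V: "finite V" using G by (simp add: simple_graph_def)
  have edge: "f' ` e \<subseteq> f' ` V \<and> card (f' ` e) = 2" if "f' \<in> inj_homs V E n" "e \<in> E" for f' e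
  proof -
    have e: "e \<subseteq> V" "card e = 2" using G that by (auto simp: simple_graph_def)
    then have "inj_on f' e" using that by (auto simp: inj_homs_def intro: inj_on_subset)
    then show ?thesis using e by (auto simp: card_image)
  qed
  show ?thesis
    unfolding simple_graph_def
  proof (intro conjI ballI)
    show "finite (union_vertices V (f, g))" using V by (simp add: union_vertices_def)
    fix e assume "e \<in> union_edges V E (f, g)"
    then obtain e' where e': "e' \<in> E" "e = f ` e' \<or> e = g ` e'"
      by (auto simp: union_edges_def copy_def)
    show "e \<subseteq> union_vertices V (f, g)" "card e = 2"
      using e'(2) edge[OF f(1) e'(1)] edge[OF f(2) e'(1)] by (auto simp: union_vertices_def)
  qed
qed

text \<open>The map \<open>h\<close> from \<open>same_overlap_hom\<close> gives the pair back by
  composition with \<open>f\<close> and \<open>g\<close>. Hence one overlap class is counted by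
  homomorphisms of a single graph.\<close>

lemma card_same_overlap_le:
  assumes f: "f \<in> inj_homs V E n" "g \<in> inj_homs V E n"
  shows "card {x \<in> inj_homs V E n \<times> inj_homs V E n. overlap V x = overlap V (f, g)}
    \<le> card (homs (union_vertices V (f, g)) (union_edges V E (f, g)) n)"
proof (rule card_inj_on_le)
  let ?L = "{x \<in> inj_homs V E n \<times> inj_homs V E n. overlap V x = overlap V (f, g)}"
  let ?P = "\<lambda>x h. h \<in> homs (union_vertices V (f, g)) (union_edges V E (f, g)) n \<and>
     (\<forall>v\<in>V. h (f v) = fst x v \<and> h (g v) = snd x v)"
  have ex: "\<exists>h. ?P x h" if "x \<in> ?L" for x
  proof -
    have "fst x \<in> inj_homs V E n" "snd x \<in> inj_homs V E n" "overlap V (fst x, snd x) = overlap V (f, g)"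
      using that by auto
    from same_overlap_hom[OF f this] show ?thesis by blast
  qed
  have P: "?P x (SOME h. ?P x h)" if "x \<in> ?L" for x
    using someI_ex[OF ex[OF that]] .
  show "(\<lambda>x. SOME h. ?P x h) ` ?L \<subseteq> homs (union_vertices V (f, g)) (union_edges V E (f, g)) n"
    using P by blast
  show "inj_on (\<lambda>x. SOME h. ?P x h) ?L"
  proof (rule inj_onI)
    fix x y assume x: "x \<in> ?L" and y: "y \<in> ?L" and eq: "(SOME h. ?P x h) = (SOME h. ?P y h)"
    obtain h where hx: "?P x h" and hy: "?P y h"
    proof
      show "?P x (SOME h. ?P x h)" by (rule P[OF x])
      show "?P y (SOME h. ?P x h)" unfolding eq by (rule P[OF y])
    qed
    have "fst x v = fst y v \<and> snd x v = snd y v" if "v \<in> V" for v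
      using bspec[OF conjunct2[OF hx] that] bspec[OF conjunct2[OF hy] that] by simp
    moreover have "fst x \<in> V \<rightarrow>\<^sub>E dg_V n" "snd x \<in> V \<rightarrow>\<^sub>E dg_V n" "fst y \<in> V \<rightarrow>\<^sub>E dg_V n" "snd y \<in> V \<rightarrow>\<^sub>E dg_V n"
      using x y by (auto simp: inj_homs_def homs_def)
    ultimately have "fst x = fst y" "snd x = snd y"
      using PiE_ext by metis+
    then show "x = y" by (rule prod_eqI)
  qed
  have "finite (union_vertices V (f, g))" using simple_graph_union[OF f] by (simp add: simple_graph_def)
  then show "finite (homs (union_vertices V (f, g)) (union_edges V E (f, g)) n)" by (rule finite_homs)
qed

text \<open>The injective map \<open>h\<close> carries one union onto the other. So the probability
  that both copies are present depends only on the overlap class.\<close>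

lemma same_overlap_card_edges:
  assumes f: "f \<in> inj_homs V E n" "g \<in> inj_homs V E n"
    and f': "f' \<in> inj_homs V E n" "g' \<in> inj_homs V E n"
    and eq: "overlap V (f', g') = overlap V (f, g)"
  shows "card (union_edges V E (f', g')) = card (union_edges V E (f, g))"
proof -
  obtain h where h: "inj_on h (union_vertices V (f, g))" "\<And>v. v \<in> V \<Longrightarrow> h (f v) = f' v" "\<And>v. v \<in> V \<Longrightarrow> h (g v) = g' v"
    using same_overlap_hom[OF assms] by blast
  have EV: "e \<subseteq> V" if "e \<in> E" for e using G that by (auto simp: simple_graph_def)
  have edges: "h ` f ` e = f' ` e" "h ` g ` e = g' ` e" if "e \<in> E" for e
    using EV[OF that] h by (force simp: image_image)+
  have "union_edges V E (f', g') = (\<lambda>e. h ` e) ` union_edges V E (f, g)"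
    using edges by (auto simp: union_edges_def copy_def image_Un image_image intro!: image_cong)
  then show ?thesis
    using inj_on_image_edges[OF simple_graph_union[OF f] h(1)] by (simp add: card_image)
qed

end

section \<open>The threshold\<close>

lemma finite_densities:
  assumes "simple_graph V E"
  shows "finite {real (card D) / real (card W) | W D. W \<subseteq> V \<and> W \<noteq> {} \<and> D \<subseteq> E \<and> (\<forall>e\<in>D. e \<subseteq> W)}"
proof -
  have "finite V" "finite E" using singletons_Un_edges[OF assms] by auto
  then have "finite ((\<lambda>(W, D). real (card D) / real (card W)) ` (Pow V \<times> Pow E))" by simp
  then show ?thesis by (rule finite_subset[rotated]) auto
qed

lemma card_le_rho_max:
  assumes G: "simple_graph V E" and W: "W \<subseteq> V" "W \<noteq> {}" "D \<subseteq> E" "\<forall>e\<in>D. e \<subseteq> W"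
  shows "card D \<le> rho_max V E * card W"
proof -
  have "finite W" using G W by (auto simp: simple_graph_def intro: finite_subset)
  then have "card W > 0" using W by (simp add: card_gt_0_iff)
  moreover have "real (card D) / real (card W) \<le> rho_max V E"
    unfolding rho_max_def using W by (intro Max_ge finite_densities[OF G]) blast
  ultimately show ?thesis by (simp add: pos_divide_le_eq)
qed

lemma rho_max_attained:
  assumes G: "simple_graph V E" and V: "V \<noteq> {}"
  obtains W D where "W \<subseteq> V" "W \<noteq> {}" "D \<subseteq> E" "\<forall>e\<in>D. e \<subseteq> W" "rho_max V E = card D / card W"
proof -
  have "rho_max V E \<in> {real (card D) / real (card W) | W D. W \<subseteq> V \<and> W \<noteq> {} \<and> D \<subseteq> E \<and> (\<forall>e\<in>D. e \<subseteq> W)}"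
    unfolding rho_max_def
  proof (rule Max_in[OF finite_densities[OF G]])
    have "real (card ({} :: 'a set set)) / real (card V) \<in> {real (card D) / real (card W) | W D. W \<subseteq> V \<and> W \<noteq> {} \<and> D \<subseteq> E \<and> (\<forall>e\<in>D. e \<subseteq> W)}"
      using V by (intro CollectI exI[of _ V] exI[of _ "{}"]) auto
    then show "{real (card D) / real (card W) | W D. W \<subseteq> V \<and> W \<noteq> {} \<and> D \<subseteq> E \<and> (\<forall>e\<in>D. e \<subseteq> W)} \<noteq> {}"
      by blast
  qed
  then show ?thesis using that by blast
qed

lemma simple_graph_nonempty:
  assumes "simple_graph V E" "E \<noteq> {}"
  shows "V \<noteq> {}" "card E > 0"
  using assms singletons_Un_edges(5)[OF assms(1)] by (auto simp: simple_graph_def card_gt_0_iff)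

lemma rho_max_pos:
  assumes G: "simple_graph V E" and E: "E \<noteq> {}"
  shows "rho_max V E > 0"
proof -
  have "0 < real (card E)" using simple_graph_nonempty[OF assms] by simp
  also have "\<dots> \<le> rho_max V E * card V"
    using G simple_graph_nonempty[OF assms] by (intro card_le_rho_max) (auto simp: simple_graph_def)
  finally show ?thesis by (simp add: zero_less_mult_iff)
qed

text \<open>Pulled back along \<open>f\<close>, the common part of two copies is a subgraph of
  \<open>(V, E)\<close> with \<open>i\<close> vertices and \<open>j\<close> edges, so the maximal
  density applies to it.\<close>

lemma overlap_density:
  assumes G: "simple_graph V E" and f: "f \<in> inj_homs V E n" "g \<in> inj_homs V E n"
  obtains i j where "card (union_vertices V (f, g)) + i = 2 * card V"
    "card (union_edges V E (f, g)) + j = 2 * card E"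
    "real j \<le> rho_max V E * i" "j > 0 \<longleftrightarrow> snd (copy V E f) \<inter> snd (copy V E g) \<noteq> {}"
proof -
  define I where "I = f ` V \<inter> g ` V"
  define J where "J = snd (copy V E f) \<inter> snd (copy V E g)"
  have fin: "finite V" "finite E" using singletons_Un_edges[OF G] by auto
  have inj: "inj_on f V" "inj_on g V" using f by (auto simp: inj_homs_def)
  have injE: "inj_on ((`) f) E" "inj_on ((`) g) E" using inj inj_on_image_edges[OF G] by auto
  have "card (union_vertices V (f, g)) + card I = 2 * card V"
    using fin card_Un_Int[of "f ` V" "g ` V"] inj by (simp add: union_vertices_def I_def card_image mult_2)
  moreover have "card (union_edges V E (f, g)) + card J = 2 * card E"
    using fin card_Un_Int[of "(\<lambda>e. f ` e) ` E" "(\<lambda>e. g ` e) ` E"] injE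
    by (simp add: union_edges_def J_def card_image copy_def mult_2)
  moreover have "real (card J) \<le> rho_max V E * card I"
  proof (cases "J = {}")
    case True
    \<comment> \<open>For \<open>V = {}\<close> the density is an unspecified maximum of the empty
      set, but then no vertex is shared either.\<close>
    have "rho_max V E \<ge> 0 \<or> V = {}"
    proof (cases "E = {}")
      case False
      then show ?thesis using rho_max_pos[OF G] by auto
    next
      case True
      then show ?thesis using rho_max_attained[OF G] by (metis divide_nonneg_nonneg of_nat_0_le_iff)
    qed
    then show ?thesis using True by (auto simp: I_def)
  next
    case False
    define W where "W = {v \<in> V. f v \<in> g ` V}"
    define D where "D = {e \<in> E. f ` e \<in> (\<lambda>e. g ` e) ` E}"
    have EV: "e \<subseteq> V" if "e \<in> E" for e using G that by (auto simp: simple_graph_def)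
    have "card W = card (f ` W)"
      using inj by (intro card_image[symmetric]) (auto simp: W_def intro: inj_on_subset)
    also have "f ` W = I" by (auto simp: W_def I_def)
    finally have W: "card W = card I" .
    have "card D = card ((`) f ` D)"
      using injE by (intro card_image[symmetric]) (auto simp: D_def intro: inj_on_subset)
    also have "(`) f ` D = J" by (auto simp: D_def J_def copy_def)
    finally have D: "card D = card J" .
    have DW: "\<forall>e\<in>D. e \<subseteq> W"
    proof
      fix e assume "e \<in> D"
      then obtain e' where e: "e \<in> E" "e' \<in> E" "f ` e = g ` e'" by (auto simp: D_def)
      show "e \<subseteq> W"
      proof
        fix v assume "v \<in> e"
        then have "f v \<in> g ` e'" using e by blast
        then show "v \<in> W" using EV[OF e(1)] EV[OF e(2)] \<open>v \<in> e\<close> by (auto simp: W_def)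
      qed
    qed
    have "finite J" using fin by (simp add: J_def copy_def)
    then have "D \<noteq> {}" using False D by auto
    then obtain e where "e \<in> D" by blast
    then have "card e = 2" "e \<subseteq> W" using DW G by (auto simp: D_def simple_graph_def)
    then have "W \<noteq> {}" by auto
    then show ?thesis
      using card_le_rho_max[OF G _ _ _ DW] W D by (auto simp: W_def D_def)
  qed
  moreover have "card J > 0 \<longleftrightarrow> snd (copy V E f) \<inter> snd (copy V E g) \<noteq> {}"
    unfolding J_def[symmetric] using fin by (simp add: card_gt_0_iff J_def copy_def)
  ultimately show ?thesis by (rule that)
qed

text \<open>With \<open>z = p / sqrt n\<close>, an overlap class with \<open>i\<close> common
  vertices and \<open>j > 0\<close> common edges contributes at most order
  \<open>N ^ (2 * card V - i) * z ^ (2 * card E - j)\<close>. This is the square of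
  \<open>N ^ card V * z ^ card E\<close> divided by \<open>N ^ i * z ^ j\<close>, a divisor that is
  at least \<open>y\<close>.\<close>

lemma overlap_sum_le:
  assumes G: "simple_graph V E" and E: "E \<noteq> {}"
  obtains C n0 where "C > 0" "\<And>n p. n \<ge> n0 \<Longrightarrow> 4 dvd n \<Longrightarrow> 0 \<le> p \<Longrightarrow>
     dg_N n powr (1 / rho_max V E) * (p / sqrt n) \<ge> 1 \<Longrightarrow>
     (\<Sum>(f, g)\<in>inj_homs V E n \<times> inj_homs V E n.
        of_bool (snd (copy V E f) \<inter> snd (copy V E g) \<noteq> {}) * p ^ card (snd (copy V E f) \<union> snd (copy V E g)))
     \<le> C * (dg_N n ^ card V * (p / sqrt n) ^ card E)\<^sup>2 / (dg_N n powr (1 / rho_max V E) * (p / sqrt n))"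
proof -
  define \<rho> where "\<rho> = rho_max V E"
  have \<rho>: "\<rho> > 0" using rho_max_pos[OF assms] by (simp add: \<rho>_def)
  have V: "finite V" using G by (simp add: simple_graph_def)
  obtain C n1 where C: "C > 0" "\<And>n (V' :: nat list set) E'. n \<ge> n1 \<Longrightarrow> 4 dvd n \<Longrightarrow> simple_graph V' E' \<Longrightarrow>
      card V' \<le> 2 * card V \<Longrightarrow> card (homs V' E' n) \<le> C * dg_N n ^ card V' / sqrt n ^ card E'"
    using card_homs_le_dg_N[where K = "2 * card V" and 'v = "nat list"] by metis
  obtain n2 where n2: "\<And>n. n \<ge> n2 \<Longrightarrow> 4 dvd n \<Longrightarrow> dg_N n > 1"
    using ln_dg_N_bounds unfolding eventually_at_top_linorder by blast
  show ?thesis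
  proof (rule that[of "2 ^ (card V)\<^sup>2 * C" "max n1 n2", folded \<rho>_def])
    show "2 ^ (card V)\<^sup>2 * C > 0" using C by simp
    fix n and p :: real
    assume n: "n \<ge> max n1 n2" "4 dvd n" and p: "0 \<le> p" and y1: "dg_N n powr (1 / \<rho>) * (p / sqrt n) \<ge> 1"
    define N where "N = dg_N n"
    define z where "z = p / sqrt n"
    define y where "y = N powr (1 / \<rho>) * z"
    define A where "A = N ^ card V * z ^ card E"
    define J where "J = inj_homs V E n"
    define \<phi> where "\<phi> = (\<lambda>(f, g). of_bool (snd (copy V E f) \<inter> snd (copy V E g) \<noteq> {}) *
        p ^ card (snd (copy V E f) \<union> snd (copy V E g)))"
    have y: "y \<ge> 1" using y1 by (simp add: y_def z_def N_def)
    have N: "N > 1" using n2[of n] n by (simp add: N_def)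
    have z: "z > 0"
    proof (rule ccontr)
      assume "\<not> z > 0"
      then have "y \<le> 0" by (simp add: y_def mult_nonneg_nonpos)
      then show False using y by simp
    qed
    have finJ: "finite J" using finite_homs[OF V] by (auto simp: J_def inj_homs_def)
    have bound: "(\<Sum>x\<in>{x \<in> J \<times> J. overlap V x = R}. \<phi> x) \<le> C * A\<^sup>2 / y" for R
    proof (cases "\<exists>x\<in>J \<times> J. overlap V x = R \<and> \<phi> x \<noteq> 0")
      case False
      then have "(\<Sum>x\<in>{x \<in> J \<times> J. overlap V x = R}. \<phi> x) = 0"
        by (intro sum.neutral) auto
      then show ?thesis using C y by simp
    next
      case True
      then obtain f g where fg: "f \<in> J" "g \<in> J" "overlap V (f, g) = R" "\<phi> (f, g) \<noteq> 0" by auto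
      then have fg': "f \<in> inj_homs V E n" "g \<in> inj_homs V E n" by (auto simp: J_def)
      obtain i j where ij: "card (union_vertices V (f, g)) + i = 2 * card V"
        "card (union_edges V E (f, g)) + j = 2 * card E"
        "real j \<le> \<rho> * i" "j > 0 \<longleftrightarrow> snd (copy V E f) \<inter> snd (copy V E g) \<noteq> {}"
        unfolding \<rho>_def by (rule overlap_density[OF G fg'])
      have j: "j > 0" using fg ij by (auto simp: \<phi>_def)
      define a b where "a = card (union_vertices V (f, g))" and "b = card (union_edges V E (f, g))"
      have "(\<Sum>x\<in>{x \<in> J \<times> J. overlap V x = R}. \<phi> x) \<le> (\<Sum>x\<in>{x \<in> J \<times> J. overlap V x = R}. p ^ b)"
      proof (rule sum_mono)
        fix x assume "x \<in> {x \<in> J \<times> J. overlap V x = R}"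
        then obtain f' g' where x: "x = (f', g')" "f' \<in> inj_homs V E n" "g' \<in> inj_homs V E n"
          "overlap V (f', g') = overlap V (f, g)"
          using fg by (auto simp: J_def)
        have "card (snd (copy V E f') \<union> snd (copy V E g')) = b"
          using same_overlap_card_edges[OF G fg' x(2-4)] by (simp add: union_edges_def b_def)
        then show "\<phi> x \<le> p ^ b" using p by (simp add: \<phi>_def x(1))
      qed
      also have "\<dots> = card {x \<in> J \<times> J. overlap V x = R} * p ^ b" by simp
      also have "\<dots> \<le> (C * N ^ a / sqrt n ^ b) * p ^ b"
      proof (intro mult_right_mono)
        have "real (card {x \<in> J \<times> J. overlap V x = R}) \<le> card (homs (union_vertices V (f, g)) (union_edges V E (f, g)) n)"
          using card_same_overlap_le[OF G fg'] fg(3) by (simp add: J_def)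
        also have "\<dots> \<le> C * N ^ a / sqrt n ^ b"
          unfolding N_def a_def b_def using n ij simple_graph_union[OF G fg'] by (intro C) auto
        finally show "real (card {x \<in> J \<times> J. overlap V x = R}) \<le> C * N ^ a / sqrt n ^ b" .
      qed (use p in auto)
      also have "\<dots> = C * (N ^ a * z ^ b)" by (simp add: z_def power_divide)
      also have "N ^ a * z ^ b \<le> A\<^sup>2 / y"
      proof -
        \<comment> \<open>Here the density condition enters: \<open>i \<ge> j / \<rho>\<close> gives
          \<open>N ^ i * z ^ j \<ge> y ^ j\<close>, and \<open>y ^ j \<ge> y\<close> because
          \<open>y \<ge> 1\<close> and \<open>j > 0\<close>.\<close>
        have "N powr (real j / \<rho>) \<le> N powr real i"
          using N ij \<rho> by (intro powr_mono) (auto simp: field_simps)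
        then have Ni: "N powr (real j / \<rho>) \<le> N ^ i" using N by (simp add: powr_realpow)
        have "y \<le> y ^ j" using y j by (intro self_le_power) auto
        also have "\<dots> = N powr (real j / \<rho>) * z ^ j"
          using N by (simp add: y_def power_mult_distrib powr_realpow[symmetric] powr_powr)
        also have "\<dots> \<le> N ^ i * z ^ j" using Ni z by (intro mult_right_mono) auto
        finally have "N ^ a * z ^ b * y \<le> N ^ a * z ^ b * (N ^ i * z ^ j)"
          using N z by (intro mult_left_mono) auto
        also have "\<dots> = N ^ (a + i) * z ^ (b + j)" by (simp add: power_add)
        also have "\<dots> = A\<^sup>2"
          using ij by (simp add: a_def b_def A_def power_mult_distrib mult.commute[of 2] flip: power_mult)
        finally show ?thesis using y by (simp add: pos_le_divide_eq)
      qed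
      then have "C * (N ^ a * z ^ b) \<le> C * (A\<^sup>2 / y)" using C by (intro mult_left_mono) auto
      finally show ?thesis by simp
    qed
    have "(\<Sum>x\<in>J \<times> J. \<phi> x) = (\<Sum>R\<in>Pow (V \<times> V). \<Sum>x\<in>{x \<in> J \<times> J. overlap V x = R}. \<phi> x)"
      using finJ V by (intro sum.group[symmetric]) (auto simp: overlap_def)
    also have "\<dots> \<le> (\<Sum>R\<in>Pow (V \<times> V). C * A\<^sup>2 / y)" by (intro sum_mono bound)
    also have "\<dots> = 2 ^ (card V)\<^sup>2 * C * A\<^sup>2 / y"
      using V by (simp add: card_Pow card_cartesian_product power2_eq_square)
    finally show "(\<Sum>(f, g)\<in>inj_homs V E n \<times> inj_homs V E n.
        of_bool (snd (copy V E f) \<inter> snd (copy V E g) \<noteq> {}) * p ^ card (snd (copy V E f) \<union> snd (copy V E g)))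
      \<le> 2 ^ (card V)\<^sup>2 * C * (dg_N n ^ card V * (p / sqrt n) ^ card E)\<^sup>2 / (dg_N n powr (1 / \<rho>) * (p / sqrt n))"
      by (simp add: \<phi>_def J_def A_def y_def N_def z_def)
  qed
qed

lemma X_F_concentrated:
  assumes G: "simple_graph V E" and E: "E \<noteq> {}"
  obtains C n0 where "C > 0" "\<And>n p \<epsilon>. n \<ge> n0 \<Longrightarrow> 4 dvd n \<Longrightarrow> 0 \<le> p \<Longrightarrow> p \<le> 1 \<Longrightarrow>
     dg_N n powr (1 / rho_max V E) * (p / sqrt n) \<ge> 1 \<Longrightarrow> \<epsilon> > 0 \<Longrightarrow>
     1 - C / (\<epsilon>\<^sup>2 * (dg_N n powr (1 / rho_max V E) * (p / sqrt n))) \<le>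
     measure_pmf.prob (Gp n p) {H. \<bar>X_F V E n H / measure_pmf.expectation (Gp n p) (X_F V E n) - 1\<bar> < \<epsilon>}"
proof -
  note NE = simple_graph_nonempty[OF assms]
  have V: "finite V" using G by (simp add: simple_graph_def)
  obtain C1 n1 where C1: "C1 > 0" "\<And>n p. n \<ge> n1 \<Longrightarrow> 4 dvd n \<Longrightarrow> 0 \<le> p \<Longrightarrow>
     dg_N n powr (1 / rho_max V E) * (p / sqrt n) \<ge> 1 \<Longrightarrow>
     (\<Sum>(f, g)\<in>inj_homs V E n \<times> inj_homs V E n.
        of_bool (snd (copy V E f) \<inter> snd (copy V E g) \<noteq> {}) * p ^ card (snd (copy V E f) \<union> snd (copy V E g)))
     \<le> C1 * (dg_N n ^ card V * (p / sqrt n) ^ card E)\<^sup>2 / (dg_N n powr (1 / rho_max V E) * (p / sqrt n))"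
    by (rule overlap_sum_le[OF assms]) blast
  obtain c n2 where c: "c > 0" "\<And>n. n \<ge> n2 \<Longrightarrow> 4 dvd n \<Longrightarrow>
      c * dg_N n ^ card V / sqrt n ^ card E \<le> card (inj_homs V E n)"
    using card_inj_homs_ge[OF G NE(1)] by metis
  obtain n3 where n3: "\<And>n. n \<ge> n3 \<Longrightarrow> 4 dvd n \<Longrightarrow> dg_N n > 1"
    using ln_dg_N_bounds unfolding eventually_at_top_linorder by blast
  define k where "k = real (card V) ^ card V"
  have k: "k > 0" using NE V by (simp add: k_def card_gt_0_iff)
  \<comment> \<open>The mean is at least \<open>c / k * A\<close>, and Chebyshev's inequality
    divides by its square.\<close>
  define C where "C = C1 * (k / c)\<^sup>2"
  show ?thesis
  proof (rule that[of C "max n1 (max n2 n3)"])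
    show "C > 0" using C1 c k by (simp add: C_def)
    fix n and p \<epsilon> :: real
    assume n: "n \<ge> max n1 (max n2 n3)" "4 dvd n" and p: "0 \<le> p" "p \<le> 1" and \<epsilon>: "\<epsilon> > 0"
      and y1: "dg_N n powr (1 / rho_max V E) * (p / sqrt n) \<ge> 1"
    define y where "y = dg_N n powr (1 / rho_max V E) * (p / sqrt n)"
    define A where "A = dg_N n ^ card V * (p / sqrt n) ^ card E"
    define I where "I = copies V E n (dg_E n)"
    define J where "J = inj_homs V E n"
    define \<mu> where "\<mu> = measure_pmf.expectation (Gp n p) (X_F V E n)"
    define S where "S = (\<Sum>(c, d)\<in>I \<times> I. of_bool (snd c \<inter> snd d \<noteq> {}) * p ^ card (snd c \<union> snd d))"
    have y: "y \<ge> 1" using y1 by (simp add: y_def)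
    have "p / sqrt n \<noteq> 0" using y1 by (intro notI) simp
    moreover have "p / sqrt n \<ge> 0" using p by simp
    ultimately have pz: "p / sqrt n > 0" by linarith
    have A: "A > 0" using n3[of n] n pz by (auto simp: A_def)
    have finJ: "finite J" using finite_homs[OF V] by (auto simp: J_def inj_homs_def)
    have IJ: "I = copy V E ` J" unfolding I_def J_def by (rule copies_eq_image_inj_homs[OF G])
    have finI: "finite I" using finJ IJ by simp
    have D: "snd c \<subseteq> dg_E n" "card (snd c) = card E" if cI: "c \<in> I" for c
    proof -
      obtain f where f: "c = copy V E f" "f \<in> J" using cI IJ by auto
      show "snd c \<subseteq> dg_E n" using f by (auto simp: J_def inj_homs_def homs_def copy_def)
      show "card (snd c) = card E"
        using f card_image[OF inj_on_image_edges[OF G, of f]] by (simp add: J_def inj_homs_def copy_def)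
    qed
    have X: "X_F V E n H = (\<Sum>c\<in>I. of_bool (snd c \<subseteq> H))" if "H \<subseteq> dg_E n" for H
      using finI copies_subset_eq[OF that, of V E] by (simp add: X_F_def I_def Int_def)
    have \<mu>_eq: "\<mu> = card I * p ^ card E"
      unfolding \<mu>_def by (rule expectation_count[OF finI D p X])
    have "c * dg_N n ^ card V / sqrt n ^ card E \<le> card J"
      unfolding J_def using n by (intro c) auto
    also have "\<dots> \<le> card I * k"
      using card_inj_homs_le_copies[OF G, of n] unfolding J_def I_def k_def
      by (metis of_nat_le_iff of_nat_mult of_nat_power)
    finally have "c * dg_N n ^ card V / sqrt n ^ card E * p ^ card E \<le> card I * k * p ^ card E"
      using p by (intro mult_right_mono) auto
    moreover have "c * A = c * dg_N n ^ card V / sqrt n ^ card E * p ^ card E"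
      by (simp add: A_def power_divide)
    moreover have "\<mu> * k = card I * k * p ^ card E" by (simp add: \<mu>_eq)
    ultimately have "c * A \<le> \<mu> * k" by linarith
    then have \<mu>_ge: "c / k * A \<le> \<mu>" using k by (simp add: pos_divide_le_eq)
    have \<mu>: "\<mu> > 0" using \<mu>_ge A c k by (meson divide_pos_pos less_le_trans mult_pos_pos)
    \<comment> \<open>Several pairs of homomorphisms may yield the same pair of copies; as the terms
      are nonnegative, this only enlarges the sum.\<close>
    have "S \<le> (\<Sum>(f, g)\<in>J \<times> J. of_bool (snd (copy V E f) \<inter> snd (copy V E g) \<noteq> {})
        * p ^ card (snd (copy V E f) \<union> snd (copy V E g)))"
    proof -
      have "I \<times> I = map_prod (copy V E) (copy V E) ` (J \<times> J)"
        unfolding IJ by (simp add: map_prod_surj_on)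
      then have "S \<le> sum ((\<lambda>(c, d). of_bool (snd c \<inter> snd d \<noteq> {}) * p ^ card (snd c \<union> snd d)) \<circ> map_prod (copy V E) (copy V E)) (J \<times> J)"
        unfolding S_def using finJ p by (simp only:) (intro sum_image_le, auto)
      then show ?thesis by (simp add: case_prod_beta)
    qed
    also have "\<dots> \<le> C1 * A\<^sup>2 / y"
      unfolding J_def A_def y_def using n p y1 by (intro C1) auto
    finally have S: "S \<le> C1 * A\<^sup>2 / y" .
    have "S / (\<epsilon>\<^sup>2 * \<mu>\<^sup>2) \<le> (C1 * A\<^sup>2 / y) / (\<epsilon>\<^sup>2 * (c / k * A)\<^sup>2)"
      using S C1 A y c k \<epsilon> \<mu> \<mu>_ge
      by (intro frac_le mult_left_mono power_mono) auto
    also have "\<dots> = C / (\<epsilon>\<^sup>2 * y)"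
      using A c k by (simp add: C_def power_mult_distrib power_divide)
    finally have "1 - C / (\<epsilon>\<^sup>2 * y) \<le> 1 - S / (\<epsilon>\<^sup>2 * \<mu>\<^sup>2)" by simp
    also have "\<dots> \<le> measure_pmf.prob (Gp n p) {H. \<bar>X_F V E n H / \<mu> - 1\<bar> < \<epsilon>}"
      unfolding \<mu>_def S_def by (rule prob_count_concentrated[OF finI D p X \<epsilon>]) (use \<mu> in \<open>simp_all add: \<mu>_def\<close>)
    finally show "1 - C / (\<epsilon>\<^sup>2 * (dg_N n powr (1 / rho_max V E) * (p / sqrt n))) \<le>
     measure_pmf.prob (Gp n p) {H. \<bar>X_F V E n H / measure_pmf.expectation (Gp n p) (X_F V E n) - 1\<bar> < \<epsilon>}"
      by (simp add: y_def \<mu>_def)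
  qed
qed

text \<open>First moment for a densest subgraph of \<open>(V, E)\<close>.\<close>
lemma prob_copies_le:
  assumes G: "simple_graph V E" and E: "E \<noteq> {}"
  obtains C n0 and d :: nat where "d > 0" "\<And>n p. n \<ge> n0 \<Longrightarrow> 4 dvd n \<Longrightarrow> 0 \<le> p \<Longrightarrow> p \<le> 1 \<Longrightarrow>
     measure_pmf.prob (Gp n p) {H. copies V E n H \<noteq> {}} \<le> C * (dg_N n powr (1 / rho_max V E) * (p / sqrt n)) ^ d"
proof -
  define \<rho> where "\<rho> = rho_max V E"
  have \<rho>: "\<rho> > 0" using rho_max_pos[OF assms] by (simp add: \<rho>_def)
  obtain W D where W: "W \<subseteq> V" "W \<noteq> {}" "D \<subseteq> E" "\<forall>e\<in>D. e \<subseteq> W" "\<rho> = card D / card W"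
    unfolding \<rho>_def by (rule rho_max_attained[OF G simple_graph_nonempty(1)[OF assms]])
  have GW: "simple_graph W D" using G W by (auto simp: simple_graph_def intro: finite_subset)
  have fW: "finite W" using GW by (simp add: simple_graph_def)
  have d: "card D > 0" "card W > 0" using \<rho> W by (auto simp: zero_less_divide_iff)
  obtain C n1 where C: "C > 0" "\<And>n (V' :: 'a set) E'. n \<ge> n1 \<Longrightarrow> 4 dvd n \<Longrightarrow> simple_graph V' E' \<Longrightarrow>
      card V' \<le> card W \<Longrightarrow> card (homs V' E' n) \<le> C * dg_N n ^ card V' / sqrt n ^ card E'"
    using card_homs_le_dg_N[where K = "card W" and 'v = 'a] by metis
  obtain n2 where n2: "\<And>n. n \<ge> n2 \<Longrightarrow> 4 dvd n \<Longrightarrow> dg_N n > 1"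
    using ln_dg_N_bounds unfolding eventually_at_top_linorder by blast
  show ?thesis
  proof (rule that[of "card D" "max n1 n2" C, folded \<rho>_def])
    fix n and p :: real
    assume n: "n \<ge> max n1 n2" "4 dvd n" and p: "0 \<le> p" "p \<le> 1"
    define J where "J = inj_homs W D n"
    have finJ: "finite J" using finite_homs[OF fW] by (auto simp: J_def inj_homs_def)
    have N: "dg_N n > 1" using n2[of n] n by simp
    \<comment> \<open>On the support, \<open>H\<close> consists of edges of the complete graph,
      which is what makes the embedding a homomorphism.\<close>
    have "{H. copies V E n H \<noteq> {}} \<inter> set_pmf (Gp n p) \<subseteq> (\<Union>f\<in>J. {H. snd (copy W D f) \<subseteq> H})"
    proof
      fix H assume H: "H \<in> {H. copies V E n H \<noteq> {}} \<inter> set_pmf (Gp n p)"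
      then have HE: "H \<subseteq> dg_E n" using set_pmf_Gp by blast
      obtain f where f: "inj_on f V" "f ` V \<subseteq> dg_V n" "(\<lambda>e. f ` e) ` E \<subseteq> H"
        using H unfolding copies_def by blast
      define g where "g = restrict f W"
      have ge: "g ` e = f ` e" if "e \<in> D" for e
        using that W(4) unfolding g_def by (intro image_cong) auto
      have gH: "g ` e \<in> H" if "e \<in> D" for e
        unfolding ge[OF that] using that W(3) f(3) by blast
      have "inj_on g W" using f(1) W(1) by (auto simp: g_def inj_on_def)
      moreover have "g \<in> W \<rightarrow>\<^sub>E dg_V n" using f(2) W(1) by (auto simp: g_def)
      ultimately have "g \<in> J" using gH HE by (auto simp: J_def inj_homs_def homs_def)
      moreover have "snd (copy W D g) \<subseteq> H" using gH by (auto simp: copy_def)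
      ultimately show "H \<in> (\<Union>f\<in>J. {H. snd (copy W D f) \<subseteq> H})" by blast
    qed
    then have "measure_pmf.prob (Gp n p) ({H. copies V E n H \<noteq> {}} \<inter> set_pmf (Gp n p))
        \<le> measure_pmf.prob (Gp n p) (\<Union>f\<in>J. {H. snd (copy W D f) \<subseteq> H})"
      by (intro measure_pmf.finite_measure_mono) auto
    then have "measure_pmf.prob (Gp n p) {H. copies V E n H \<noteq> {}}
        \<le> measure_pmf.prob (Gp n p) (\<Union>f\<in>J. {H. snd (copy W D f) \<subseteq> H})"
      by (simp add: measure_Int_set_pmf)
    also have "\<dots> \<le> (\<Sum>f\<in>J. measure_pmf.prob (Gp n p) {H. snd (copy W D f) \<subseteq> H})"
      using finJ by (intro measure_pmf.finite_measure_subadditive_finite) auto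
    also have "\<dots> = (\<Sum>f\<in>J. p ^ card D)"
    proof (rule sum.cong)
      fix f assume f: "f \<in> J"
      then have "snd (copy W D f) \<subseteq> dg_E n" by (auto simp: J_def inj_homs_def homs_def copy_def)
      moreover have "card (snd (copy W D f)) = card D"
        using f card_image[OF inj_on_image_edges[OF GW, of f]] by (simp add: J_def inj_homs_def copy_def)
      ultimately show "measure_pmf.prob (Gp n p) {H. snd (copy W D f) \<subseteq> H} = p ^ card D"
        using prob_Gp_superset p by simp
    qed simp
    also have "\<dots> = card J * p ^ card D" by simp
    also have "\<dots> \<le> (C * dg_N n ^ card W / sqrt n ^ card D) * p ^ card D"
    proof (intro mult_right_mono)
      have "card J \<le> card (homs W D n)"
        unfolding J_def using finite_homs[OF fW] by (intro card_mono) (auto simp: inj_homs_def)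
      then show "real (card J) \<le> C * dg_N n ^ card W / sqrt n ^ card D"
        using C(2)[of n W D] n GW by simp
    qed (use p in auto)
    also have "\<dots> = C * (dg_N n powr (1 / \<rho>) * (p / sqrt n)) ^ card D"
    proof -
      \<comment> \<open>Because \<open>(W, D)\<close> attains the maximal density, the first moment
        is an exact power of the governing parameter.\<close>
      have "(dg_N n powr (1 / \<rho>)) ^ card D = dg_N n powr (card D / \<rho>)"
        using N by (simp add: powr_realpow[symmetric] powr_powr)
      also have "card D / \<rho> = card W" using W(5) d by simp
      also have "dg_N n powr card W = dg_N n ^ card W" using N by (simp add: powr_realpow)
      finally show ?thesis by (simp add: power_mult_distrib power_divide)
    qed
    finally show "measure_pmf.prob (Gp n p) {H. copies V E n H \<noteq> {}}
        \<le> C * (dg_N n powr (1 / \<rho>) * (p / sqrt n)) ^ card D" .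
  qed (rule d)
qed

text \<open>Since \<open>ln N\<close> is of order \<open>n\<close>, the quantities \<open>p / p\<^sup>*\<close> and \<open>N\<^bsup>1/\<rho>\<^esup> p / \<surd>n\<close> are of the same order.\<close>
lemma p_star_ratio_bounds:
  assumes "\<And>n. 0 \<le> p n"
  shows "eventually (\<lambda>m. p (4*m) / p_star V E (4*m) / 2 \<le> dg_N (4*m) powr (1 / rho_max V E) * (p (4*m) / sqrt (4*m)) \<and>
      dg_N (4*m) powr (1 / rho_max V E) * (p (4*m) / sqrt (4*m)) \<le> p (4*m) / p_star V E (4*m)) sequentially"
proof -
  obtain n0 where n0: "\<And>n. n \<ge> n0 \<Longrightarrow> 4 dvd n \<Longrightarrow> real n / 4 \<le> ln (dg_N n) \<and> ln (dg_N n) \<le> n \<and> dg_N n > 1"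
    using ln_dg_N_bounds unfolding eventually_at_top_linorder by blast
  have "eventually (\<lambda>m. m \<ge> max 1 n0) sequentially" by (rule eventually_ge_at_top)
  then show ?thesis
  proof eventually_elim
    case (elim m)
    define n where "n = 4 * m"
    define L where "L = sqrt (ln (dg_N n))"
    have n: "n \<ge> n0" "4 dvd n" "n > 0" using elim by (auto simp: n_def)
    note N = n0[OF n(1,2)]
    \<comment> \<open>The lower bound \<open>n / 4\<close> for \<open>ln N\<close> is the origin of
      the factor 2 in the statement.\<close>
    have "sqrt (n / 4) \<le> L" unfolding L_def using N by (intro real_sqrt_le_mono) simp
    then have L1: "sqrt n / 2 \<le> L" by (simp add: real_sqrt_divide)
    have L2: "L \<le> sqrt n" unfolding L_def using N by (intro real_sqrt_le_mono) simp
    have sq: "sqrt n > 0" using n by simp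
    have L: "L > 0" using L1 sq by linarith
    define Q where "Q = dg_N n powr (1 / rho_max V E) * p n"
    have Q: "Q \<ge> 0" using assms by (simp add: Q_def)
    have r: "p n / p_star V E n = Q / L"
      by (simp add: p_star_def Q_def L_def powr_minus_divide)
    have "Q / L / 2 \<le> Q / sqrt n"
    proof -
      have "Q * sqrt n \<le> Q * (2 * L)" using Q L1 by (intro mult_left_mono) auto
      then show ?thesis using L sq by (simp add: field_simps)
    qed
    moreover have "Q / sqrt n \<le> Q / L" using Q L L2 sq by (intro divide_left_mono mult_pos_pos) auto
    ultimately show ?case
      unfolding n_def[symmetric] r by (simp add: Q_def n_def)
  qed
qed

theorem theorem5:
  fixes VF :: "'a set" and EF :: "'a set set" and p :: "nat \<Rightarrow> real"
  assumes "simple_graph VF EF" and "EF \<noteq> {}"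
    and "\<And>n. 0 \<le> p n \<and> p n \<le> 1"
  shows "((\<lambda>m. p (4*m)) \<in> o(\<lambda>m. p_star VF EF (4*m)) \<longrightarrow>
           ((\<lambda>m. measure_pmf.prob (Gp (4*m) (p (4*m))) {H. copies VF EF (4*m) H \<noteq> {}})
              \<longlonglongrightarrow> 0))
       \<and> (filterlim (\<lambda>m. p (4*m) / p_star VF EF (4*m)) at_top sequentially \<longrightarrow>
           ((\<lambda>m. measure_pmf.prob (Gp (4*m) (p (4*m))) {H. copies VF EF (4*m) H \<noteq> {}})
              \<longlonglongrightarrow> 1)
           \<and> (\<forall>\<epsilon>>0. (\<lambda>m. measure_pmf.prob (Gp (4*m) (p (4*m)))
                 {H. \<bar>X_F VF EF (4*m) H /
                       measure_pmf.expectation (Gp (4*m) (p (4*m))) (X_F VF EF (4*m)) - 1\<bar> < \<epsilon>})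
               \<longlonglongrightarrow> 1))"
proof -
  define r where "r = (\<lambda>m. p (4*m) / p_star VF EF (4*m))"
  define y where "y = (\<lambda>m. dg_N (4*m) powr (1 / rho_max VF EF) * (p (4*m) / sqrt (4*m)))"
  have p: "0 \<le> p n" "p n \<le> 1" for n using assms(3) by auto
  have y0: "y m \<ge> 0" for m using p by (simp add: y_def)
  have ry: "eventually (\<lambda>m. r m / 2 \<le> y m \<and> y m \<le> r m) sequentially"
    unfolding r_def y_def by (rule p_star_ratio_bounds) (rule p)
  have part1: "(\<lambda>m. measure_pmf.prob (Gp (4*m) (p (4*m))) {H. copies VF EF (4*m) H \<noteq> {}}) \<longlonglongrightarrow> 0"
    if "(\<lambda>m. p (4*m)) \<in> o(\<lambda>m. p_star VF EF (4*m))"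
  proof -
    have "r \<longlonglongrightarrow> 0" unfolding r_def using that by (rule smalloD_tendsto)
    then have y: "y \<longlonglongrightarrow> 0"
      by (rule tendsto_sandwich[OF _ _ tendsto_const, rotated 2]) (use ry y0 in \<open>auto elim: eventually_mono\<close>)
    obtain C d n0 where C: "d > 0" "\<And>n p. n \<ge> n0 \<Longrightarrow> 4 dvd n \<Longrightarrow> 0 \<le> p \<Longrightarrow> p \<le> 1 \<Longrightarrow>
       measure_pmf.prob (Gp n p) {H. copies VF EF n H \<noteq> {}} \<le> C * (dg_N n powr (1 / rho_max VF EF) * (p / sqrt n)) ^ d"
      by (rule prob_copies_le[OF assms(1,2)]) blast
    have le: "eventually (\<lambda>m. measure_pmf.prob (Gp (4*m) (p (4*m))) {H. copies VF EF (4*m) H \<noteq> {}} \<le> C * y m ^ d) sequentially"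
      using eventually_ge_at_top[of n0]
    proof eventually_elim
      case (elim m)
      then show ?case using C(2)[of "4*m" "p (4*m)"] p by (simp add: y_def)
    qed
    have lim: "(\<lambda>m. C * y m ^ d) \<longlonglongrightarrow> 0"
      using tendsto_mult[OF tendsto_const tendsto_power[OF y, of d], of C] C(1) by (simp add: power_0_left)
    show ?thesis
      by (rule tendsto_sandwich[OF _ le tendsto_const lim]) simp
  qed
  have part2: "(\<lambda>m. measure_pmf.prob (Gp (4*m) (p (4*m)))
        {H. \<bar>X_F VF EF (4*m) H / measure_pmf.expectation (Gp (4*m) (p (4*m))) (X_F VF EF (4*m)) - 1\<bar> < \<epsilon>}) \<longlonglongrightarrow> 1"
    if "filterlim r at_top sequentially" and \<epsilon>: "\<epsilon> > 0" for \<epsilon>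
  proof -
    have "filterlim (\<lambda>m. (1/2) * r m) at_top sequentially"
      by (rule filterlim_tendsto_pos_mult_at_top[OF tendsto_const _ that(1)]) simp
    then have y: "filterlim y at_top sequentially"
      by (rule filterlim_at_top_mono) (use ry in \<open>auto elim: eventually_mono\<close>)
    obtain C n0 where C: "\<And>n p \<epsilon>. n \<ge> n0 \<Longrightarrow> 4 dvd n \<Longrightarrow> 0 \<le> p \<Longrightarrow> p \<le> 1 \<Longrightarrow>
       dg_N n powr (1 / rho_max VF EF) * (p / sqrt n) \<ge> 1 \<Longrightarrow> \<epsilon> > 0 \<Longrightarrow>
       1 - C / (\<epsilon>\<^sup>2 * (dg_N n powr (1 / rho_max VF EF) * (p / sqrt n))) \<le>
       measure_pmf.prob (Gp n p) {H. \<bar>X_F VF EF n H / measure_pmf.expectation (Gp n p) (X_F VF EF n) - 1\<bar> < \<epsilon>}"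
      by (rule X_F_concentrated[OF assms(1,2)]) blast
    have "eventually (\<lambda>m. y m \<ge> 1) sequentially"
      using y by (simp add: filterlim_at_top)
    with eventually_ge_at_top[of n0]
    have ge: "eventually (\<lambda>m. 1 - C / \<epsilon>\<^sup>2 / y m \<le> measure_pmf.prob (Gp (4*m) (p (4*m)))
        {H. \<bar>X_F VF EF (4*m) H / measure_pmf.expectation (Gp (4*m) (p (4*m))) (X_F VF EF (4*m)) - 1\<bar> < \<epsilon>}) sequentially"
    proof eventually_elim
      case (elim m)
      then show ?case using C[of "4*m" "p (4*m)" \<epsilon>] p \<epsilon> by (simp add: y_def)
    qed
    have lim: "(\<lambda>m. 1 - C / \<epsilon>\<^sup>2 / y m) \<longlonglongrightarrow> 1"
      using tendsto_diff[OF tendsto_const real_tendsto_divide_at_top[OF tendsto_const y, of "C / \<epsilon>\<^sup>2"], of 1] by simp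
    show ?thesis
      by (rule tendsto_sandwich[OF ge _ lim tendsto_const]) simp
  qed
  \<comment> \<open>Concentration with \<open>\<epsilon> = 1\<close> suffices: without copies
    \<open>X_F\<close> is 0, and the deviation is exactly 1, even for mean 0, since division by zero
    yields 0.\<close>
  have part3: "(\<lambda>m. measure_pmf.prob (Gp (4*m) (p (4*m))) {H. copies VF EF (4*m) H \<noteq> {}}) \<longlonglongrightarrow> 1"
    if "filterlim r at_top sequentially"
  proof (rule tendsto_sandwich[OF _ _ part2[OF that zero_less_one] tendsto_const])
    show "eventually (\<lambda>m. measure_pmf.prob (Gp (4*m) (p (4*m)))
        {H. \<bar>X_F VF EF (4*m) H / measure_pmf.expectation (Gp (4*m) (p (4*m))) (X_F VF EF (4*m)) - 1\<bar> < 1}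
        \<le> measure_pmf.prob (Gp (4*m) (p (4*m))) {H. copies VF EF (4*m) H \<noteq> {}}) sequentially"
      by (intro always_eventually allI measure_pmf.finite_measure_mono) (auto simp: X_F_def)
  qed auto
  show ?thesis using part1 part2 part3 unfolding r_def by blast
qed

end
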